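(* Let $Y$ be a connected real analytic submanifold of $\mathbb R^n\cong M_{n,1}(\mathbb R)$ of dimension $d\ge 2$ that is not contained in any rational affine hyperplane. Suppose $f:\mathbb R_{>0}\to\mathbb R_{>0}$ is continuous and non-increasing and satisfies $t^{\frac{1}{n-d+1}}f(t)\to\infty$ monotonically as $t\to\infty$. Then $\operatorname{UA}^*_{n,1}(f)\cap Y$ is dense in $Y$ and uncountable. In particular, there exists a dense uncountable set of totally irrational $\mathbf{x}\in Y$ with $\hat\omega(\mathbf{x})\ge\frac{1}{n-d+1}$.
   Context: Vectors $\mathbf{x}\in\mathbb R^n$ are viewed as column vectors ($n\times 1$ matrices). For $f:\mathbb R_{>0}\to\mathbb R_{>0}$, $\operatorname{UA}_{n,1}(f)$ is the set of $\mathbf{x}$ such that for every sufficiently large $t>0$ there exist $q\in\mathbb Z\smallsetminus\{0\}$ and $\mathbf{p}\in\mathbb Z^n$ with $|q|\le t$ and $\|q\mathbf{x}-\mathbf{p}\|\le f(t)$ (sup norm). $\operatorname{UA}^*_{n,1}(f)$ is the set of totally irrational elements of $\operatorname{UA}_{n,1}(f)$, where totally irrational means not contained in any proper rational affine subspace of $\mathbb R^n$. The uniform exponent $\hat\omega(\mathbf{x})$ is the supremum of $a>0$ such that $\mathbf{x}\in\operatorname{UA}_{n,1}(t\mapsto t^{-a})$. *)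

theory Defs
  imports "HOL-Analysis.Analysis"
begin

text \<open>A map is real analytic on an open set if, near each of its points, it is the sum of a
  multivariate power series. Multi-indices are functions \<open>\<alpha> :: 'n \<Rightarrow> nat\<close>, and the
  (unconditional, hence absolute) sum ranges over all of them.\<close>

definition real_analytic_on :: "(real ^ 'n \<Rightarrow> real ^ 'm) \<Rightarrow> (real ^ 'n) set \<Rightarrow> bool"
    (infix "real'_analytic'_on" 50) where
  "g real_analytic_on U \<longleftrightarrow> open U \<and>
     (\<forall>x\<in>U. \<exists>(c :: ('n \<Rightarrow> nat) \<Rightarrow> real ^ 'm) r. r > 0 \<and>
        (\<forall>y\<in>ball x r.
           ((\<lambda>\<alpha>. (\<Prod>i\<in>UNIV. (y $ i - x $ i) ^ \<alpha> i) *\<^sub>R c \<alpha>) has_sum g y) UNIV))"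

text \<open>Embedded (not necessarily closed) submanifolds, via local charts of the ambient space that
  flatten \<open>Y\<close>. As the dimension \<open>d\<close> is a number and not a type, the model of \<open>\<real>\<^sup>d\<close> inside \<open>\<real>\<^sup>n\<close>
  is a linear subspace \<open>W\<close> of dimension \<open>d\<close>; a linear change of coordinates makes it a
  coordinate subspace.\<close>

definition real_analytic_submanifold :: "nat \<Rightarrow> (real ^ 'n) set \<Rightarrow> bool" where
  "real_analytic_submanifold d Y \<longleftrightarrow>
     (\<forall>y\<in>Y. \<exists>(U :: (real ^ 'n) set) (V :: (real ^ 'n) set) \<phi> \<psi> W.
        y \<in> U \<and> homeomorphism U V \<phi> \<psi> \<and> \<phi> real_analytic_on U \<and> \<psi> real_analytic_on V \<and>
        subspace W \<and> dim W = d \<and> \<phi> ` (U \<inter> Y) = V \<inter> W)"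

definition rational_affine_hyperplane :: "(real ^ 'n) set \<Rightarrow> bool" where
  "rational_affine_hyperplane H \<longleftrightarrow>
     (\<exists>a b. a \<noteq> 0 \<and> (\<forall>i. a $ i \<in> \<rat>) \<and> b \<in> \<rat> \<and> H = {x. a \<bullet> x = b})"

text \<open>Solution sets of finite systems of linear equations with rational coefficients. An
  inconsistent system gives the empty set, which is harmless below.\<close>

definition rational_affine_subspace :: "(real ^ 'n) set \<Rightarrow> bool" where
  "rational_affine_subspace L \<longleftrightarrow>
     (\<exists>E. finite E \<and> (\<forall>(a, b)\<in>E. (\<forall>i. a $ i \<in> \<rat>) \<and> b \<in> \<rat>) \<and>
          L = {x. \<forall>(a, b)\<in>E. a \<bullet> x = b})"

definition totally_irrational :: "real ^ 'n \<Rightarrow> bool" where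
  "totally_irrational x \<longleftrightarrow> \<not> (\<exists>L. rational_affine_subspace L \<and> L \<noteq> UNIV \<and> x \<in> L)"

text \<open>Only the values of \<open>f\<close> at large positive arguments matter. The library's \<open>infnorm\<close> is the
  sup norm.\<close>

definition UA :: "(real \<Rightarrow> real) \<Rightarrow> (real ^ 'n) set" where
  "UA f = {x. \<forall>\<^sub>F t in at_top. \<exists>(q :: int) (p :: int ^ 'n).
             q \<noteq> 0 \<and> \<bar>real_of_int q\<bar> \<le> t \<and>
             infnorm (real_of_int q *\<^sub>R x - (\<chi> i. real_of_int (p $ i))) \<le> f t}"

definition UA_star :: "(real \<Rightarrow> real) \<Rightarrow> (real ^ 'n) set" where
  "UA_star f = {x \<in> UA f. totally_irrational x}"

text \<open>The supremum is taken in the extended reals, since it is infinite for rational \<open>x\<close>.\<close>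

definition uniform_exponent :: "real ^ 'n \<Rightarrow> ereal" where
  "uniform_exponent x = (SUP a \<in> {a. a > 0 \<and> x \<in> UA (\<lambda>t. t powr (- a))}. ereal a)"

end

theory Submission
  imports Defs
begin

text \<open>Near each of its points \<open>Y\<close> has a continuous parametrisation \<open>s\<close> by a ball of the ambient space
  with \<open>s u - u\<close> in a fixed coordinate subspace \<open>K\<close> of dimension \<open>n - d\<close> transversal to \<open>Y\<close>. If \<open>u\<close>
  moves along a rational line, \<open>s u\<close> stays in the sum of that line and \<open>K\<close>, a rational affine subspace
  of dimension \<open>n - d + 1\<close>, on which Dirichlet's theorem gives uniform approximation with exponent
  \<open>1 / (n - d + 1)\<close>, hence better than \<open>f\<close> for all \<open>t \<ge> T\<close>. This allows a Khintchine-type construction: walk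
  from a rational point a tiny rational distance along a rational line to the next one, so short that
  approximability persists up to the time from which the subspace of the new line takes over.
  The direction of each line is chosen so as to leave one rational hyperplane: an analytic function that
  does not vanish identically is nonzero on a truncated open cone at each point. Since \<open>s u\<close> is never
  totally irrational for rational \<open>u\<close>, any given sequence of totally irrational points can be avoided
  as well, so no countable set exhausts the limits.\<close>

section \<open>Expansion of analytic functions into homogeneous polynomials\<close>

text \<open>The difficulty is one of order: a step can be made short enough only once the time is
  known from which its endpoint is well approximated. This is not circular, because Dirichlet's
  constant depends on the rational line and on \<open>K\<close> but not on the point of the line:
  the direction is fixed, the takeover time is read off, and the step length is chosen last. The
  exponent counts free real numbers, namely \<open>n - d\<close> coordinates in \<open>K\<close> and
  one parameter along the line. \<open>K\<close> has to be spanned by coordinate axes, since an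
  arbitrary complement of the tangent space need not be rational. Analyticity enters through the
  identity theorem, by which every relatively open piece of \<open>Y\<close> leaves every rational
  hyperplane. The section itself is handled only as a differentiable map, the inverse of a map with
  a two-point lower bound. Its path over a rational line therefore has merely a tangent direction in
  the chart, which is why nonvanishing is needed on a cone and not just on a ray.\<close>

text \<open>\<open>P k\<close> is the part of degree \<open>k\<close> of the power series at \<open>x\<close>, and \<open>B k\<close> the sum of the absolute
  values of its coefficients.\<close>

definition hom_expansion ::
    "(real ^ 'n \<Rightarrow> real) \<Rightarrow> real ^ 'n \<Rightarrow> real \<Rightarrow> (nat \<Rightarrow> real ^ 'n \<Rightarrow> real) \<Rightarrow> (nat \<Rightarrow> real) \<Rightarrow> bool" where
  "hom_expansion h x \<rho> P B \<longleftrightarrow>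
     \<rho> > 0 \<and> (\<forall>k. B k \<ge> 0) \<and> summable (\<lambda>k. B k * \<rho> ^ k) \<and>
     (\<forall>z. infnorm z \<le> \<rho> \<longrightarrow> (\<lambda>k. P k z) sums h (x + z)) \<and>
     (\<forall>k t z. P k (t *\<^sub>R z) = t ^ k * P k z) \<and>
     (\<forall>k z. \<bar>P k z\<bar> \<le> B k * infnorm z ^ k) \<and>
     (\<forall>k s z z'. infnorm z \<le> s \<longrightarrow> infnorm z' \<le> s \<longrightarrow>
        \<bar>P k z - P k z'\<bar> \<le> B k * (real k * s ^ (k - 1) * infnorm (z - z'))) \<and>
     linear (P 1)"

text \<open>Scalar functions suffice: a vector-valued \<open>g\<close> enters only through functions
  \<open>a \<bullet> g y - b\<close>, its coordinates among them. The Lipschitz clause serves to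
  perturb directions in the leading form and to compare the series at two points.\<close>

definition analytic_at :: "(real ^ 'n \<Rightarrow> real) \<Rightarrow> real ^ 'n \<Rightarrow> bool" where
  "analytic_at h x \<longleftrightarrow> (\<exists>\<rho> P B. hom_expansion h x \<rho> P B)"

lemma finite_multi_indices: "finite {\<alpha> :: 'n::finite \<Rightarrow> nat. sum \<alpha> UNIV = k}"
proof (rule finite_subset)
  show "{\<alpha> :: 'n \<Rightarrow> nat. sum \<alpha> UNIV = k} \<subseteq> PiE UNIV (\<lambda>_. {..k})"
    by (auto simp: PiE_def intro!: member_le_sum)
qed (auto intro: finite_PiE)

text \<open>The multi-indices split into the finite fibres of the degree, and an unconditional sum
  may be taken fibre by fibre.\<close>

lemma has_sum_group_degree:
  fixes F :: "('n::finite \<Rightarrow> nat) \<Rightarrow> real"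
  assumes "(F has_sum S) UNIV"
  shows "(\<lambda>k. \<Sum>\<alpha> | sum \<alpha> UNIV = k. F \<alpha>) sums S"
proof -
  let ?A = "Sigma (UNIV :: nat set) (\<lambda>k. {\<alpha> :: 'n \<Rightarrow> nat. sum \<alpha> UNIV = k})"
  have inj: "inj_on snd ?A" by (auto simp: inj_on_def)
  have im: "snd ` ?A = UNIV" by force
  have "((F \<circ> snd) has_sum S) ?A"
    using assms has_sum_reindex[OF inj, of F S] im by simp
  then have "((\<lambda>k. \<Sum>\<alpha> | sum \<alpha> UNIV = k. F \<alpha>) has_sum S) UNIV"
    by (rule has_sum_SigmaD) (auto intro!: has_sum_finite finite_multi_indices)
  then show ?thesis by (rule has_sum_imp_sums)
qed

text \<open>A mean value bound for monomials: replace one elementary factor at a time. Each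
  replacement costs at most \<open>M\<close>, while the other \<open>sum \<alpha> A - 1\<close>
  factors are at most \<open>s\<close>. For degree 0 the truncated subtraction is harmless, since
  the leading factor is 0.\<close>

lemma abs_prod_diff_le:
  fixes a b :: "'i \<Rightarrow> real"
  assumes "finite A" and "\<And>i. i \<in> A \<Longrightarrow> \<bar>a i\<bar> \<le> s" "\<And>i. i \<in> A \<Longrightarrow> \<bar>b i\<bar> \<le> s"
    and "\<And>i. i \<in> A \<Longrightarrow> \<bar>a i - b i\<bar> \<le> M" and s: "s \<ge> 0"
  shows "\<bar>(\<Prod>i\<in>A. a i ^ \<alpha> i) - (\<Prod>i\<in>A. b i ^ \<alpha> i)\<bar> \<le> real (sum \<alpha> A) * s ^ (sum \<alpha> A - 1) * M"
  using assms(1-4)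
proof (induction A rule: finite_induct)
  case empty
  then show ?case by simp
next
  case (insert j A)
  have M: "M \<ge> 0" using insert.prems(3)[of j] by auto
  have split: "\<bar>x * p - y * q\<bar> \<le> \<bar>x\<bar> * \<bar>p - q\<bar> + \<bar>x - y\<bar> * \<bar>q\<bar>" for x y p q :: real
  proof -
    have "x * p - y * q = x * (p - q) + (x - y) * q" by (simp add: algebra_simps)
    then show ?thesis by (metis abs_mult abs_triangle_ineq)
  qed
  have pow: "\<bar>a j ^ m - b j ^ m\<bar> \<le> real m * s ^ (m - 1) * M" for m
  proof (induction m)
    case 0
    then show ?case by simp
  next
    case (Suc m)
    have "a j ^ Suc m - b j ^ Suc m = a j * (a j ^ m - b j ^ m) + (a j - b j) * b j ^ m"
      by (simp add: algebra_simps)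
    then have "\<bar>a j ^ Suc m - b j ^ Suc m\<bar> \<le> \<bar>a j\<bar> * \<bar>a j ^ m - b j ^ m\<bar> + \<bar>a j - b j\<bar> * \<bar>b j\<bar> ^ m"
      by (metis abs_mult abs_triangle_ineq power_abs)
    also have "\<dots> \<le> s * (real m * s ^ (m - 1) * M) + M * s ^ m"
      using insert.prems by (intro add_mono mult_mono Suc power_mono) (auto simp: s M)
    also have "\<dots> = real (Suc m) * s ^ (Suc m - 1) * M"
      by (cases m) (simp_all add: algebra_simps)
    finally show ?case .
  qed
  define k where "k = sum \<alpha> A"
  let ?p = "\<Prod>i\<in>A. a i ^ \<alpha> i" and ?q = "\<Prod>i\<in>A. b i ^ \<alpha> i"
  have q: "\<bar>?q\<bar> \<le> s ^ k"
    unfolding k_def power_sum abs_prod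
    by (rule prod_mono) (use insert.prems in \<open>auto simp: power_abs intro!: power_mono\<close>)
  have aj: "\<bar>a j ^ \<alpha> j\<bar> \<le> s ^ \<alpha> j"
    using insert.prems(1)[of j] by (auto simp: power_abs intro!: power_mono)
  have "\<bar>a j ^ \<alpha> j * ?p - b j ^ \<alpha> j * ?q\<bar> \<le>
      \<bar>a j ^ \<alpha> j\<bar> * \<bar>?p - ?q\<bar> + \<bar>a j ^ \<alpha> j - b j ^ \<alpha> j\<bar> * \<bar>?q\<bar>"
    by (rule split)
  also have "\<dots> \<le> s ^ \<alpha> j * (real k * s ^ (k - 1) * M) + (real (\<alpha> j) * s ^ (\<alpha> j - 1) * M) * s ^ k"
    unfolding k_def using insert
    by (intro add_mono mult_mono aj pow q[unfolded k_def] insert.IH) (auto simp: s M)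
  also have "\<dots> = real (k + \<alpha> j) * s ^ (k + \<alpha> j - 1) * M"
    by (cases k; cases "\<alpha> j") (simp_all add: algebra_simps power_add)
  finally show ?case
    using insert by (simp add: k_def add.commute)
qed

lemma power_series_imp_analytic_at:
  fixes h :: "real ^ 'n \<Rightarrow> real" and c :: "('n \<Rightarrow> nat) \<Rightarrow> real"
  assumes r: "r > 0"
    and sum: "\<And>y. y \<in> ball x r \<Longrightarrow> ((\<lambda>\<alpha>. (\<Prod>i\<in>UNIV. (y $ i - x $ i) ^ \<alpha> i) * c \<alpha>) has_sum h y) UNIV"
  shows "analytic_at h x"
proof -
  \<comment> \<open>The series converges on a Euclidean ball but the estimates use the sup norm; by
    the l1 bound the cube of half-side \<open>\<rho>\<close> lies inside the ball of radius
    \<open>r\<close>.\<close>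
  define \<rho> where "\<rho> = r / (real CARD('n) + 1)"
  define P where "P k z = (\<Sum>\<alpha> | sum \<alpha> UNIV = k. (\<Prod>i\<in>UNIV. (z $ i) ^ \<alpha> i) * c \<alpha>)" for k and z :: "real ^ 'n"
  define B where "B k = (\<Sum>\<alpha> | sum \<alpha> UNIV = k. \<bar>c \<alpha>\<bar>)" for k
  have \<rho>: "\<rho> > 0" using r by (simp add: \<rho>_def)
  have ball: "x + z \<in> ball x r" if "infnorm z \<le> \<rho>" for z
  proof -
    have "norm z \<le> (\<Sum>i\<in>UNIV. \<bar>z $ i\<bar>)" by (rule norm_le_l1_cart)
    also have "\<dots> \<le> (\<Sum>i\<in>(UNIV::'n set). \<rho>)"
      using component_le_infnorm_cart[of z] that by (intro sum_mono) (meson order_trans)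
    also have "\<dots> < r" using r by (simp add: \<rho>_def field_simps)
    finally show ?thesis by (simp add: dist_norm)
  qed
  have sums: "(\<lambda>k. P k z) sums h (x + z)" if "infnorm z \<le> \<rho>" for z
    using has_sum_group_degree[OF sum[OF ball[OF that]]] by (simp add: P_def)
  have summ: "summable (\<lambda>k. B k * \<rho> ^ k)"
  proof -
    \<comment> \<open>At the diagonal point every monomial of degree \<open>k\<close> equals
      \<open>\<rho> ^ k\<close>. As unconditional summability of reals is absolute, this one point
      controls all the coefficient sums \<open>B k\<close>.\<close>
    let ?z = "(\<chi> i. \<rho>) :: real ^ 'n"
    have "infnorm ?z \<le> \<rho>"
      using \<rho> by (subst infnorm_cart) (rule cSup_least, auto)
    have "((\<lambda>\<alpha>. (\<Prod>i\<in>UNIV. ((x + ?z) $ i - x $ i) ^ \<alpha> i) * c \<alpha>) has_sum h (x + ?z)) UNIV"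
      by (rule sum[OF ball]) fact
    moreover have "(\<Prod>i\<in>UNIV. ((x + ?z) $ i - x $ i) ^ \<alpha> i) = \<rho> ^ sum \<alpha> UNIV" for \<alpha>
      by (simp add: power_sum)
    ultimately have "((\<lambda>\<alpha>. \<rho> ^ sum \<alpha> UNIV * c \<alpha>) has_sum h (x + ?z)) UNIV"
      by (simp only:)
    then have "(\<lambda>\<alpha>. \<rho> ^ sum \<alpha> UNIV * c \<alpha>) summable_on UNIV"
      by (rule has_sum_imp_summable)
    then have "(\<lambda>\<alpha>. norm (\<rho> ^ sum \<alpha> UNIV * c \<alpha>)) summable_on UNIV"
      by (rule summable_on_iff_abs_summable_on_real[THEN iffD1])
    then obtain S where "((\<lambda>\<alpha>. norm (\<rho> ^ sum \<alpha> UNIV * c \<alpha>)) has_sum S) UNIV"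
      unfolding summable_on_def by blast
    then have "(\<lambda>k. \<Sum>\<alpha> | sum \<alpha> UNIV = k. norm (\<rho> ^ sum \<alpha> UNIV * c \<alpha>)) sums S"
      by (rule has_sum_group_degree)
    moreover have "(\<Sum>\<alpha> | sum \<alpha> UNIV = k. norm (\<rho> ^ sum \<alpha> UNIV * c \<alpha>)) = B k * \<rho> ^ k" for k
      using \<rho> by (simp add: B_def abs_mult mult.commute flip: sum_distrib_right)
    ultimately show ?thesis by (simp add: sums_iff)
  qed
  have scal: "P k (t *\<^sub>R z) = t ^ k * P k z" for k t z
    unfolding P_def sum_distrib_left
    by (rule sum.cong) (auto simp: power_mult_distrib prod.distrib power_sum)
  have lip: "\<bar>P k z - P k z'\<bar> \<le> B k * (real k * s ^ (k - 1) * infnorm (z - z'))"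
    if "infnorm z \<le> s" "infnorm z' \<le> s" for k s z z'
  proof -
    have s: "s \<ge> 0" using that(1) infnorm_pos_le[of z] by linarith
    have "P k z - P k z' =
        (\<Sum>\<alpha> | sum \<alpha> UNIV = k. ((\<Prod>i\<in>UNIV. (z $ i) ^ \<alpha> i) - (\<Prod>i\<in>UNIV. (z' $ i) ^ \<alpha> i)) * c \<alpha>)"
      by (simp add: P_def sum_subtractf left_diff_distrib)
    also have "\<bar>\<dots>\<bar> \<le> (\<Sum>\<alpha> | sum \<alpha> UNIV = k. (real k * s ^ (k - 1) * infnorm (z - z')) * \<bar>c \<alpha>\<bar>)"
    proof (rule order_trans[OF sum_abs], rule sum_mono)
      fix \<alpha> :: "'n \<Rightarrow> nat" assume "\<alpha> \<in> {\<alpha>. sum \<alpha> UNIV = k}"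
      then have k: "k = sum \<alpha> UNIV" by simp
      show "\<bar>((\<Prod>i\<in>UNIV. (z $ i) ^ \<alpha> i) - (\<Prod>i\<in>UNIV. (z' $ i) ^ \<alpha> i)) * c \<alpha>\<bar>
          \<le> (real k * s ^ (k - 1) * infnorm (z - z')) * \<bar>c \<alpha>\<bar>"
        unfolding abs_mult k
        using component_le_infnorm_cart[of z] component_le_infnorm_cart[of z'] that
          component_le_infnorm_cart[of "z - z'"]
        by (intro mult_right_mono abs_prod_diff_le) (auto intro: order_trans s)
    qed
    also have "\<dots> = B k * (real k * s ^ (k - 1) * infnorm (z - z'))"
      by (simp add: B_def sum_distrib_left sum_distrib_right mult.commute)
    finally show ?thesis .
  qed
  have bd: "\<bar>P k z\<bar> \<le> B k * infnorm z ^ k" for k z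
    unfolding P_def B_def sum_distrib_right
  proof (rule order_trans[OF sum_abs], rule sum_mono)
    fix \<alpha> :: "'n \<Rightarrow> nat" assume "\<alpha> \<in> {\<alpha>. sum \<alpha> UNIV = k}"
    then have k: "k = sum \<alpha> UNIV" by simp
    have "\<bar>\<Prod>i\<in>UNIV. (z $ i) ^ \<alpha> i\<bar> \<le> infnorm z ^ k"
      unfolding k power_sum abs_prod
      by (rule prod_mono) (auto simp: power_abs component_le_infnorm_cart intro!: power_mono)
    then show "\<bar>(\<Prod>i\<in>UNIV. (z $ i) ^ \<alpha> i) * c \<alpha>\<bar> \<le> \<bar>c \<alpha>\<bar> * infnorm z ^ k"
      by (simp add: abs_mult mult.commute mult_left_mono)
  qed
  have lin: "linear (P 1)"
  proof (rule linearI)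
    fix z z' :: "real ^ 'n" and t :: real
    show "P 1 (t *\<^sub>R z) = t *\<^sub>R P 1 z" using scal[of 1 t z] by simp
    have "(\<Prod>i\<in>UNIV. ((z + z') $ i) ^ \<alpha> i) = (\<Prod>i\<in>UNIV. (z $ i) ^ \<alpha> i) + (\<Prod>i\<in>UNIV. (z' $ i) ^ \<alpha> i)"
      if sum1: "sum \<alpha> UNIV = 1" for \<alpha>
    proof -
      obtain j where j: "\<alpha> j = 1" "\<And>i. i \<noteq> j \<Longrightarrow> \<alpha> i = 0"
        using sum_eq_1_iff[of UNIV \<alpha>, THEN iffD1, OF finite sum1] by auto
      have "(\<Prod>i\<in>UNIV. (y $ i) ^ \<alpha> i) = y $ j" for y :: "real ^ 'n"
      proof -
        have "(\<Prod>i\<in>UNIV. (y $ i) ^ \<alpha> i) = (\<Prod>i\<in>{j}. (y $ i) ^ \<alpha> i)"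
          by (rule prod.mono_neutral_right) (auto simp: j)
        then show ?thesis by (simp add: j)
      qed
      then show ?thesis by (simp only: vector_add_component[symmetric])
    qed
    then show "P 1 (z + z') = P 1 z + P 1 z'"
      by (simp add: P_def distrib_right flip: sum.distrib)
  qed
  have "hom_expansion h x \<rho> P B"
    unfolding hom_expansion_def
    using \<rho> summ sums scal lip bd lin by (auto simp: B_def sum_nonneg)
  then show ?thesis unfolding analytic_at_def by blast
qed

lemma real_analytic_on_imp_analytic_at:
  fixes g :: "real ^ 'n \<Rightarrow> real ^ 'm"
  assumes "g real_analytic_on U" "x \<in> U"
  shows "analytic_at (\<lambda>y. a \<bullet> g y - b) x"
proof -
  obtain c r where r: "r > 0" and c: "\<forall>y\<in>ball x r.
      ((\<lambda>\<alpha>. (\<Prod>i\<in>UNIV. (y $ i - x $ i) ^ \<alpha> i) *\<^sub>R c \<alpha>) has_sum g y) UNIV"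
    using assms(1)[unfolded real_analytic_on_def, THEN conjunct2, rule_format, OF assms(2)] by auto
  \<comment> \<open>The constant \<open>- b\<close> becomes a coefficient at the zero multi-index,
    whose monomial is 1.\<close>
  define e where "e \<alpha> = (if \<alpha> = (\<lambda>_. 0) then - b else 0)" for \<alpha> :: "'n \<Rightarrow> nat"
  have "((\<lambda>\<alpha>. (\<Prod>i\<in>UNIV. (y $ i - x $ i) ^ \<alpha> i) * (a \<bullet> c \<alpha> + e \<alpha>)) has_sum (a \<bullet> g y - b)) UNIV"
    if "y \<in> ball x r" for y
  proof -
    have "((\<lambda>\<alpha>. a \<bullet> ((\<Prod>i\<in>UNIV. (y $ i - x $ i) ^ \<alpha> i) *\<^sub>R c \<alpha>)) has_sum a \<bullet> g y) UNIV"
      using has_sum_bounded_linear[OF bounded_linear_inner_right bspec[OF c that]] by (simp add: o_def)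
    moreover have "(e has_sum (- b)) UNIV"
      using has_sum_finite_neutralI[of "{\<lambda>_. 0}" UNIV e] by (simp add: e_def)
    ultimately have "((\<lambda>\<alpha>. a \<bullet> ((\<Prod>i\<in>UNIV. (y $ i - x $ i) ^ \<alpha> i) *\<^sub>R c \<alpha>) + e \<alpha>)
        has_sum (a \<bullet> g y + - b)) UNIV"
      by (rule has_sum_add)
    moreover have "a \<bullet> ((\<Prod>i\<in>UNIV. (y $ i - x $ i) ^ \<alpha> i) *\<^sub>R c \<alpha>) + e \<alpha> =
        (\<Prod>i\<in>UNIV. (y $ i - x $ i) ^ \<alpha> i) * (a \<bullet> c \<alpha> + e \<alpha>)" for \<alpha>
      by (simp add: e_def algebra_simps)
    ultimately show ?thesis by (simp only: diff_conv_add_uminus)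
  qed
  with r show ?thesis by (rule power_series_imp_analytic_at)
qed

section \<open>Nonvanishing, strict differentiability and an identity theorem for analytic
  functions\<close>

text \<open>The lowest form \<open>P m\<close> that is not zero on \<open>W\<close> scales like
  \<open>t ^ m\<close> and stays away from 0 for directions near \<open>z\<close>, whereas the
  remaining tail is of order \<open>\<bar>t\<bar> ^ (m + 1)\<close>. When \<open>m = 0\<close> the
  direction \<open>z\<close> may be 0.\<close>

lemma analytic_nonzero_on_cone:
  fixes h :: "real ^ 'n \<Rightarrow> real"
  assumes an: "analytic_at h x" and W: "subspace W"
    and nz: "\<And>e. e > 0 \<Longrightarrow> \<exists>z\<in>W. norm z < e \<and> h (x + z) \<noteq> 0"
  obtains z \<epsilon> \<delta> where "z \<in> W" "\<epsilon> > 0" "\<delta> > 0"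
    "\<And>z' t. z' \<in> W \<Longrightarrow> norm (z' - z) < \<epsilon> \<Longrightarrow> 0 < \<bar>t\<bar> \<Longrightarrow> \<bar>t\<bar> < \<delta> \<Longrightarrow> h (x + t *\<^sub>R z') \<noteq> 0"
proof -
  obtain \<rho> P B where \<rho>: "\<rho> > 0" and B: "\<And>k. B k \<ge> 0" and summ: "summable (\<lambda>k. B k * \<rho> ^ k)"
    and sums: "\<And>z. infnorm z \<le> \<rho> \<Longrightarrow> (\<lambda>k. P k z) sums h (x + z)"
    and scal: "\<And>k t z. P k (t *\<^sub>R z) = t ^ k * P k z"
    and bd: "\<And>k z. \<bar>P k z\<bar> \<le> B k * infnorm z ^ k"
    and lip: "\<And>k s z z'. infnorm z \<le> s \<Longrightarrow> infnorm z' \<le> s \<Longrightarrow>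
        \<bar>P k z - P k z'\<bar> \<le> B k * (real k * s ^ (k - 1) * infnorm (z - z'))"
    using an unfolding analytic_at_def hom_expansion_def by blast
  have "\<exists>k. \<exists>z\<in>W. P k z \<noteq> 0"
  proof (rule ccontr)
    assume no: "\<not> ?thesis"
    obtain z where z: "z \<in> W" "norm z < \<rho>" "h (x + z) \<noteq> 0" using nz[OF \<rho>] by blast
    have "(\<lambda>k. P k z) sums h (x + z)" using sums infnorm_le_norm[of z] z(2) by simp
    moreover have "(\<lambda>k. P k z) = (\<lambda>k. 0)" using no z(1) by auto
    ultimately show False using z(3) sums_unique2[OF sums_zero] by metis
  qed
  define m where "m = (LEAST k. \<exists>z\<in>W. P k z \<noteq> 0)"
  obtain z where z: "z \<in> W" "P m z \<noteq> 0"
    unfolding m_def using LeastI_ex[OF \<open>\<exists>k. \<exists>z\<in>W. P k z \<noteq> 0\<close>] by blast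
  have low: "P k z' = 0" if "k < m" "z' \<in> W" for k z'
    using not_less_Least[of k "\<lambda>k. \<exists>z\<in>W. P k z \<noteq> 0"] that unfolding m_def by blast
  define \<eta> where "\<eta> = \<bar>P m z\<bar>"
  define R where "R = infnorm z + 1"
  define C where "C = B m * (real m * R ^ (m - 1))"
  \<comment> \<open>\<open>C\<close> is a Lipschitz constant of \<open>P m\<close> on the sup-norm
    ball of radius \<open>R\<close>, which contains every \<open>z'\<close> within 1 of
    \<open>z\<close>. Moving by less than \<open>\<epsilon>\<close> thus costs at most half of
    \<open>\<eta>\<close>.\<close>
  define \<epsilon> where "\<epsilon> = min 1 (\<eta> / (2 * (C + 1)))"
  have \<eta>: "\<eta> > 0" using z by (simp add: \<eta>_def)
  have R: "R > 0" using infnorm_pos_le[of z] by (simp add: R_def)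
  have C: "C \<ge> 0" using B R by (simp add: C_def)
  have \<epsilon>: "\<epsilon> > 0" using \<eta> C by (simp add: \<epsilon>_def)
  have near: "infnorm z' \<le> R \<and> \<bar>P m z'\<bar> \<ge> \<eta> / 2" if "norm (z' - z) < \<epsilon>" for z'
  proof -
    have n: "infnorm (z - z') < \<epsilon>" using that infnorm_le_norm[of "z - z'"] by (simp add: norm_minus_commute)
    have "infnorm z' \<le> infnorm z + infnorm (z - z')"
      using absdiff_infnorm[of z z'] by linarith
    then have 1: "infnorm z' \<le> R" using n by (simp add: R_def \<epsilon>_def)
    have "\<bar>P m z - P m z'\<bar> \<le> C * infnorm (z - z')"
      using lip[OF _ 1, of z m] by (simp add: C_def R_def mult.assoc)
    also have "\<dots> \<le> C * (\<eta> / (2 * (C + 1)))"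
      using n by (intro mult_left_mono C) (simp add: \<epsilon>_def)
    also have "\<dots> \<le> \<eta> / 2" using \<eta> C by (simp add: field_simps)
    finally have "\<bar>P m z - P m z'\<bar> \<le> \<eta> / 2" .
    then show ?thesis using 1 unfolding \<eta>_def by linarith
  qed
  \<comment> \<open>For \<open>\<bar>t\<bar> \<le> \<tau>\<close> the point
    \<open>t *\<^sub>R z'\<close> stays in the domain of the expansion, and
    \<open>\<bar>t\<bar> * R = (\<bar>t\<bar> / \<tau>) * \<rho>\<close> lets \<open>T\<close>, the
    tail at radius \<open>\<rho>\<close>, dominate.\<close>
  define \<tau> where "\<tau> = \<rho> / R"
  have \<tau>: "\<tau> > 0" using \<rho> R by (simp add: \<tau>_def)
  define T where "T k = B (k + Suc m) * \<rho> ^ (k + Suc m)" for k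
  have T: "summable T" unfolding T_def by (rule summable_ignore_initial_segment[OF summ])
  have T0: "T k \<ge> 0" for k using B \<rho> by (simp add: T_def)
  define D where "D = suminf T / \<tau> ^ Suc m"
  have D: "D \<ge> 0" using \<tau> suminf_nonneg[OF T T0] by (simp add: D_def)
  \<comment> \<open>The tail is at most \<open>\<bar>t\<bar> ^ m * (\<bar>t\<bar> * D)\<close>; the
    second term of the minimum makes this smaller than
    \<open>\<bar>t\<bar> ^ m * (\<eta> / 2)\<close>.\<close>
  define \<delta> where "\<delta> = min \<tau> (\<eta> / (2 * (D + 1)))"
  have \<delta>: "\<delta> > 0" using \<tau> \<eta> D by (simp add: \<delta>_def)
  have main: "h (x + t *\<^sub>R z') \<noteq> 0" if z': "z' \<in> W" "norm (z' - z) < \<epsilon>" and t: "0 < \<bar>t\<bar>" "\<bar>t\<bar> < \<delta>" for z' t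
  proof
    assume h0: "h (x + t *\<^sub>R z') = 0"
    have t\<tau>: "\<bar>t\<bar> \<le> \<tau>" using t by (simp add: \<delta>_def)
    have tR: "infnorm (t *\<^sub>R z') \<le> \<bar>t\<bar> * R"
      using near[OF z'(2)] by (simp add: infnorm_mul mult_left_mono)
    also have "\<dots> \<le> \<rho>" using t\<tau> R by (simp add: \<tau>_def field_simps)
    finally have s: "(\<lambda>k. P k (t *\<^sub>R z')) sums 0" using sums[of "t *\<^sub>R z'"] h0 by simp
    have "(\<Sum>k<Suc m. P k (t *\<^sub>R z')) = P m (t *\<^sub>R z')"
      using low subspace_scale[OF W z'(1)] by simp
    then have s2: "(\<lambda>k. P (k + Suc m) (t *\<^sub>R z')) sums (- P m (t *\<^sub>R z'))"
      using sums_split_initial_segment[OF s, of "Suc m"] by simp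
    have le: "norm (P (k + Suc m) (t *\<^sub>R z')) \<le> (\<bar>t\<bar> / \<tau>) ^ Suc m * T k" for k
    proof -
      have "\<bar>P (k + Suc m) (t *\<^sub>R z')\<bar> \<le> B (k + Suc m) * (\<bar>t\<bar> * R) ^ (k + Suc m)"
        by (rule order_trans[OF bd mult_left_mono[OF power_mono[OF tR]]]) (simp_all add: B infnorm_pos_le)
      also have "(\<bar>t\<bar> * R) ^ (k + Suc m) = (\<bar>t\<bar> / \<tau>) ^ (k + Suc m) * \<rho> ^ (k + Suc m)"
        using \<rho> R by (simp add: \<tau>_def flip: power_mult_distrib)
      also have "B (k + Suc m) * \<dots> \<le> B (k + Suc m) * ((\<bar>t\<bar> / \<tau>) ^ Suc m * \<rho> ^ (k + Suc m))"
        using t\<tau> \<tau> \<rho> by (intro mult_left_mono mult_right_mono power_decreasing) (auto simp: B)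
      finally show ?thesis by (simp add: T_def mult.left_commute)
    qed
    have "norm (\<Sum>k. P (k + Suc m) (t *\<^sub>R z')) \<le> (\<Sum>k. (\<bar>t\<bar> / \<tau>) ^ Suc m * T k)"
      by (rule norm_suminf_le[OF le]) (intro summable_mult T)
    then have "\<bar>P m (t *\<^sub>R z')\<bar> \<le> (\<bar>t\<bar> / \<tau>) ^ Suc m * suminf T"
      unfolding suminf_mult[OF T] sums_unique[OF s2, symmetric] by simp
    also have "\<dots> = \<bar>t\<bar> ^ m * (\<bar>t\<bar> * D)" by (simp add: D_def power_divide)
    also have "\<dots> < \<bar>t\<bar> ^ m * (\<eta> / 2)"
    proof -
      have "\<bar>t\<bar> * D \<le> \<bar>t\<bar> * (D + 1)" by (simp add: mult_left_mono)
      also have "\<dots> < \<eta> / 2" using t(2) D by (simp add: \<delta>_def field_simps)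
      finally show ?thesis using t(1) by (simp add: mult_strict_left_mono)
    qed
    also have "\<dots> \<le> \<bar>t\<bar> ^ m * \<bar>P m z'\<bar>" using near[OF z'(2)] by (intro mult_left_mono) auto
    also have "\<dots> = \<bar>P m (t *\<^sub>R z')\<bar>" by (simp add: scal abs_mult power_abs)
    finally show False by simp
  qed
  show ?thesis by (rule that[OF z(1) \<epsilon> \<delta> main])
qed

text \<open>The estimate compares two arbitrary points near \<open>x\<close>. This is what later
  gives a two-point lower bound, hence local injectivity and a Lipschitz inverse, in place of an
  inverse function theorem for continuously differentiable maps.\<close>

lemma analytic_strictly_differentiable:
  fixes h :: "real ^ 'n \<Rightarrow> real"
  assumes an: "analytic_at h x"
  obtains A where "linear A"
    "\<And>\<epsilon>. \<epsilon> > 0 \<Longrightarrow> \<exists>\<delta>>0. \<forall>y y'. norm (y - x) < \<delta> \<longrightarrow> norm (y' - x) < \<delta> \<longrightarrow>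
        \<bar>h y - h y' - A (y - y')\<bar> \<le> \<epsilon> * norm (y - y')"
proof -
  obtain \<rho> P B where \<rho>: "\<rho> > 0" and B: "\<And>k. B k \<ge> 0" and summ: "summable (\<lambda>k. B k * \<rho> ^ k)"
    and sums: "\<And>z. infnorm z \<le> \<rho> \<Longrightarrow> (\<lambda>k. P k z) sums h (x + z)"
    and lip: "\<And>k s z z'. infnorm z \<le> s \<Longrightarrow> infnorm z' \<le> s \<Longrightarrow>
        \<bar>P k z - P k z'\<bar> \<le> B k * (real k * s ^ (k - 1) * infnorm (z - z'))"
    and lin: "linear (P 1)"
    using an unfolding analytic_at_def hom_expansion_def by blast
  define T where "T k = B (k + 2) * \<rho> ^ (k + 2)" for k
  have T: "summable T" unfolding T_def by (rule summable_ignore_initial_segment[OF summ])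
  have T0: "T k \<ge> 0" for k using B \<rho> by (simp add: T_def)
  have S: "suminf T \<ge> 0" using suminf_nonneg[OF T T0] .
  have "\<exists>\<delta>>0. \<forall>y y'. norm (y - x) < \<delta> \<longrightarrow> norm (y' - x) < \<delta> \<longrightarrow>
        \<bar>h y - h y' - P 1 (y - y')\<bar> \<le> \<epsilon> * norm (y - y')" if \<epsilon>: "\<epsilon> > 0" for \<epsilon>
  proof -
    \<comment> \<open>The first term absorbs the factor \<open>k + 2 \<le> 2 ^ (k + 2)\<close> into
      \<open>(2 * \<delta>) ^ k \<le> \<rho> ^ k\<close>; the second makes
      \<open>4 * \<delta> / \<rho>\<^sup>2 * suminf T\<close> at most
      \<open>\<epsilon>\<close>.\<close>
    define \<delta> where "\<delta> = min (\<rho> / 2) (\<epsilon> * \<rho>\<^sup>2 / (4 * (suminf T + 1)))"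
    have \<delta>: "\<delta> > 0" using \<rho> \<epsilon> S by (simp add: \<delta>_def)
    have "\<bar>h y - h y' - P 1 (y - y')\<bar> \<le> \<epsilon> * norm (y - y')"
      if y: "norm (y - x) < \<delta>" "norm (y' - x) < \<delta>" for y y'
    proof -
      define z z' where "z = y - x" and "z' = y' - x"
      have z: "infnorm z \<le> \<delta>" "infnorm z' \<le> \<delta>"
        using y infnorm_le_norm[of z] infnorm_le_norm[of z'] by (auto simp: z_def z'_def)
      have \<delta>\<rho>: "\<delta> \<le> \<rho>" "2 * \<delta> \<le> \<rho>" using \<rho> by (auto simp: \<delta>_def)
      have "(\<lambda>k. P k z) sums h (x + z)" "(\<lambda>k. P k z') sums h (x + z')"
        using z \<delta>\<rho> by (auto intro!: sums)
      then have s: "(\<lambda>k. P k z - P k z') sums (h y - h y')"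
        using sums_diff by (fastforce simp: z_def z'_def)
      have "P 0 z - P 0 z' = 0" using lip[OF z, of 0] by simp
      moreover have "P 1 z - P 1 z' = P 1 (y - y')"
        using linear_diff[OF lin, of z z'] by (simp add: z_def z'_def)
      ultimately have s2: "(\<lambda>k. P (k + 2) z - P (k + 2) z') sums (h y - h y' - P 1 (y - y'))"
        using sums_split_initial_segment[OF s, of 2] by (simp add: numeral_2_eq_2)
      define M where "M = 4 * \<delta> / \<rho>\<^sup>2 * infnorm (z - z')"
      have le: "norm (P (k + 2) z - P (k + 2) z') \<le> M * T k" for k
      proof -
        have "real (k + 2) \<le> 2 ^ (k + 2)" using of_nat_less_two_power[of "k + 2", where 'a = real] by (simp add: less_imp_le)
        then have "real (k + 2) * \<delta> ^ (k + 1) \<le> 2 ^ (k + 2) * \<delta> ^ (k + 1)"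
          using \<delta> by (intro mult_right_mono) auto
        also have "\<dots> = 4 * \<delta> * (2 * \<delta>) ^ k" by (simp add: power_mult_distrib)
        also have "\<dots> \<le> 4 * \<delta> * \<rho> ^ k" using \<delta> \<delta>\<rho> by (intro mult_left_mono power_mono) auto
        finally have *: "real (k + 2) * \<delta> ^ (k + 1) \<le> 4 * \<delta> * \<rho> ^ k" .
        have "\<bar>P (k + 2) z - P (k + 2) z'\<bar> \<le> B (k + 2) * (real (k + 2) * \<delta> ^ (k + 1) * infnorm (z - z'))"
          using lip[OF z, of "k + 2"] by simp
        also have "\<dots> \<le> B (k + 2) * (4 * \<delta> * \<rho> ^ k * infnorm (z - z'))"
          by (intro mult_left_mono mult_right_mono * B infnorm_pos_le)
        also have "\<dots> = M * T k"
          using \<rho> by (simp add: M_def T_def power2_eq_square field_simps)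
        finally show ?thesis by simp
      qed
      have "norm (\<Sum>k. P (k + 2) z - P (k + 2) z') \<le> (\<Sum>k. M * T k)"
        by (rule norm_suminf_le[OF le]) (intro summable_mult T)
      then have "\<bar>h y - h y' - P 1 (y - y')\<bar> \<le> M * suminf T"
        using s2 suminf_mult[OF T] by (simp add: sums_iff)
      also have "\<dots> \<le> \<epsilon> * infnorm (z - z')"
      proof -
        have "4 * \<delta> / \<rho>\<^sup>2 * suminf T \<le> 4 * \<delta> / \<rho>\<^sup>2 * (suminf T + 1)"
          using \<delta> by (intro mult_left_mono) auto
        also have "\<dots> \<le> \<epsilon>"
        proof -
          have "\<delta> \<le> \<epsilon> * \<rho>\<^sup>2 / (4 * (suminf T + 1))" by (simp add: \<delta>_def)
          then show ?thesis using S \<rho> by (simp add: field_simps)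
        qed
        finally show ?thesis
          using mult_right_mono[OF _ infnorm_pos_le[of "z - z'"]] by (fastforce simp: M_def mult_ac)
      qed
      also have "\<dots> \<le> \<epsilon> * norm (y - y')"
        using \<epsilon> infnorm_le_norm[of "z - z'"] by (simp add: z_def z'_def)
      finally show ?thesis .
    qed
    with \<delta> show ?thesis by blast
  qed
  with lin show ?thesis by (rule that)
qed

text \<open>Along the line, \<open>Z\<close> is the interior of the zero set and \<open>N\<close>
  consists of the parameters with a zero-free punctured neighbourhood. Both are open and they are
  disjoint; the cone lemma on the subspace spanned by \<open>v\<close> shows that they cover the
  unit interval, which is connected.\<close>

lemma analytic_line_identity:
  fixes h :: "real ^ 'n \<Rightarrow> real"
  assumes an: "\<And>t. 0 \<le> t \<Longrightarrow> t \<le> 1 \<Longrightarrow> analytic_at h (x + t *\<^sub>R v)"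
    and e: "e > 0" and zero: "\<And>t. \<bar>t\<bar> < e \<Longrightarrow> h (x + t *\<^sub>R v) = 0"
  shows "h (x + v) = 0"
proof (cases "v = 0")
  case True
  then show ?thesis using zero[of 0] e by simp
next
  case v: False
  define Z where "Z = {t. \<exists>e>0. \<forall>s. \<bar>s - t\<bar> < e \<longrightarrow> h (x + s *\<^sub>R v) = 0}"
  define N where "N = {t. \<exists>e>0. \<forall>s. 0 < \<bar>s - t\<bar> \<and> \<bar>s - t\<bar> < e \<longrightarrow> h (x + s *\<^sub>R v) \<noteq> 0}"
  have "open Z"
    unfolding open_dist
  proof
    fix t assume "t \<in> Z"
    then obtain e where e: "e > 0" "\<And>s. \<bar>s - t\<bar> < e \<Longrightarrow> h (x + s *\<^sub>R v) = 0" unfolding Z_def by blast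
    have "t' \<in> Z" if "dist t' t < e" for t'
      unfolding Z_def mem_Collect_eq
      by (rule exI[of _ "e - \<bar>t' - t\<bar>"]) (use that e(2) in \<open>auto simp: dist_real_def\<close>)
    with e(1) show "\<exists>e>0. \<forall>t'. dist t' t < e \<longrightarrow> t' \<in> Z" by blast
  qed
  have "open N"
    unfolding open_dist
  proof
    fix t assume "t \<in> N"
    then obtain e where e: "e > 0" "\<And>s. 0 < \<bar>s - t\<bar> \<Longrightarrow> \<bar>s - t\<bar> < e \<Longrightarrow> h (x + s *\<^sub>R v) \<noteq> 0"
      unfolding N_def by blast
    have "t' \<in> N" if "dist t' t < e" for t'
    proof (cases "t' = t")
      case True
      then show ?thesis using \<open>t \<in> N\<close> by simp
    next
      case False
      show ?thesis unfolding N_def mem_Collect_eq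
        by (rule exI[of _ "min (e - \<bar>t' - t\<bar>) \<bar>t' - t\<bar>"])
          (use False that e(2) in \<open>auto simp: dist_real_def\<close>)
    qed
    with e(1) show "\<exists>e>0. \<forall>t'. dist t' t < e \<longrightarrow> t' \<in> N" by blast
  qed
  have cover: "t \<in> Z \<union> N" if t: "0 \<le> t" "t \<le> 1" for t
  proof (cases "\<forall>e>0. \<exists>z\<in>range (\<lambda>s. s *\<^sub>R v). norm z < e \<and> h (x + t *\<^sub>R v + z) \<noteq> 0")
    case True
    have sub: "subspace (range (\<lambda>s. s *\<^sub>R v))"
      using subspace_span[of "{v}"] by (simp add: span_singleton)
    have nz0: "\<And>e. e > 0 \<Longrightarrow> \<exists>z\<in>range (\<lambda>s. s *\<^sub>R v). norm z < e \<and> h (x + t *\<^sub>R v + z) \<noteq> 0"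
      using True by blast
    obtain z \<epsilon> \<delta> where z: "z \<in> range (\<lambda>s. s *\<^sub>R v)" "\<epsilon> > 0" "\<delta> > 0"
      and nz: "\<And>z' s. z' \<in> range (\<lambda>s. s *\<^sub>R v) \<Longrightarrow> norm (z' - z) < \<epsilon> \<Longrightarrow> 0 < \<bar>s\<bar> \<Longrightarrow> \<bar>s\<bar> < \<delta> \<Longrightarrow>
        h (x + t *\<^sub>R v + s *\<^sub>R z') \<noteq> 0"
      by (rule analytic_nonzero_on_cone[OF an[OF t] sub nz0], assumption) (rule that)
    obtain l0 where l0: "z = l0 *\<^sub>R v" using z(1) by blast
    \<comment> \<open>The axis \<open>z\<close> of the cone may be 0, but a reparametrisation of the
      line needs a nonzero multiple of \<open>v\<close>; one is found within
      \<open>\<epsilon>\<close> of \<open>z\<close>.\<close>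
    obtain l where l: "l \<noteq> 0" "norm (l *\<^sub>R v - z) < \<epsilon>"
    proof (cases "l0 = 0")
      case True
      show ?thesis
        by (rule that[of "\<epsilon> / 2 / norm v"]) (use z v True l0 in auto)
    qed (use that[of l0] l0 z in auto)
    have "h (x + s *\<^sub>R v) \<noteq> 0" if s: "0 < \<bar>s - t\<bar>" "\<bar>s - t\<bar> < \<delta> * \<bar>l\<bar>" for s
    proof -
      have "h (x + t *\<^sub>R v + ((s - t) / l) *\<^sub>R (l *\<^sub>R v)) \<noteq> 0"
        using s l by (intro nz) (auto simp: field_simps)
      also have "x + t *\<^sub>R v + ((s - t) / l) *\<^sub>R (l *\<^sub>R v) = x + s *\<^sub>R v"
        using l by (simp add: scaleR_left_diff_distrib)
      finally show ?thesis .
    qed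
    moreover have "\<delta> * \<bar>l\<bar> > 0" using z l by simp
    ultimately show ?thesis unfolding N_def by blast
  next
    case False
    then obtain e where e: "e > 0"
      "\<And>s. norm (s *\<^sub>R v) < e \<Longrightarrow> h (x + t *\<^sub>R v + s *\<^sub>R v) = 0" by blast
    have "h (x + s *\<^sub>R v) = 0" if s: "\<bar>s - t\<bar> < e / norm v" for s
    proof -
      have "h (x + t *\<^sub>R v + (s - t) *\<^sub>R v) = 0"
        using s v by (intro e(2)) (simp add: pos_less_divide_eq)
      then show ?thesis by (simp add: algebra_simps)
    qed
    then have "t \<in> Z" unfolding Z_def using e v by (auto intro!: exI[of _ "e / norm v"])
    then show ?thesis by simp
  qed
  have disj: "Z \<inter> N = {}"
  proof (rule ccontr)
    assume "Z \<inter> N \<noteq> {}"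
    then obtain t e1 e2 where "e1 > 0" "e2 > 0" and
      "\<And>s. \<bar>s - t\<bar> < e1 \<Longrightarrow> h (x + s *\<^sub>R v) = 0"
      "\<And>s. 0 < \<bar>s - t\<bar> \<Longrightarrow> \<bar>s - t\<bar> < e2 \<Longrightarrow> h (x + s *\<^sub>R v) \<noteq> 0"
      unfolding Z_def N_def by blast
    moreover have "\<bar>t + min e1 e2 / 2 - t\<bar> < e1" "\<bar>t + min e1 e2 / 2 - t\<bar> < e2" "0 < \<bar>t + min e1 e2 / 2 - t\<bar>"
      using calculation(1,2) by (simp_all add: min_def)
    ultimately show False by metis
  qed
  have "0 \<in> Z" unfolding Z_def using e zero by auto
  have "t \<in> Z \<union> N" if "t \<in> {0..1}" for t using cover[of t] that by simp
  then have "{0..1} \<subseteq> Z \<union> N" by blast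
  then have "N \<inter> {0..1} = {}"
    using connectedD[OF connected_Icc \<open>open Z\<close> \<open>open N\<close>, of 0 1] disj \<open>0 \<in> Z\<close> by fastforce
  then have "1 \<in> Z" using cover[of 1] by auto
  then obtain e1 where "e1 > 0" "\<And>s. \<bar>s - 1\<bar> < e1 \<Longrightarrow> h (x + s *\<^sub>R v) = 0"
    unfolding Z_def by blast
  from this(1) this(2)[of 1] show ?thesis by simp
qed

section \<open>Analytic submanifolds\<close>

lemma real_analytic_on_open: "g real_analytic_on U \<Longrightarrow> open U"
  by (simp add: real_analytic_on_def)

lemma real_analytic_strictly_differentiable:
  fixes g :: "real ^ 'n \<Rightarrow> real ^ 'm"
  assumes g: "g real_analytic_on U" and x: "x \<in> U"
  obtains A where "linear A"
    "\<And>\<epsilon>. \<epsilon> > 0 \<Longrightarrow> \<exists>\<delta>>0. \<forall>y y'. norm (y - x) < \<delta> \<longrightarrow> norm (y' - x) < \<delta> \<longrightarrow>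
        norm (g y - g y' - A (y - y')) \<le> \<epsilon> * norm (y - y')"
proof -
  have "\<exists>A. linear A \<and> (\<forall>\<epsilon>>0. \<exists>\<delta>>0. \<forall>y y'. norm (y - x) < \<delta> \<longrightarrow> norm (y' - x) < \<delta> \<longrightarrow>
        \<bar>g y $ i - g y' $ i - A (y - y')\<bar> \<le> \<epsilon> * norm (y - y'))" for i
  proof -
    have "analytic_at (\<lambda>y. g y $ i) x"
      using real_analytic_on_imp_analytic_at[OF g x, of "axis i 1" 0] by (simp add: inner_axis')
    from analytic_strictly_differentiable[OF this] show ?thesis by metis
  qed
  then obtain A where A: "\<And>i. linear (A i)" and sd: "\<And>i \<epsilon>. \<epsilon> > 0 \<Longrightarrow> \<exists>\<delta>>0. \<forall>y y'. norm (y - x) < \<delta> \<longrightarrow>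
      norm (y' - x) < \<delta> \<longrightarrow> \<bar>g y $ i - g y' $ i - A i (y - y')\<bar> \<le> \<epsilon> * norm (y - y')"
    by metis
  show ?thesis
  proof (rule that)
    show "linear (\<lambda>v. \<chi> i. A i v)"
      by (rule linearI) (simp_all add: vec_eq_iff linear_add[OF A] linear_cmul[OF A])
    fix \<epsilon> :: real assume \<epsilon>: "\<epsilon> > 0"
    define e where "e = \<epsilon> / real CARD('m)"
    have e: "e > 0" using \<epsilon> by (simp add: e_def)
    obtain d where d: "\<And>i. d i > 0" "\<And>i y y'. norm (y - x) < d i \<Longrightarrow> norm (y' - x) < d i \<Longrightarrow>
        \<bar>g y $ i - g y' $ i - A i (y - y')\<bar> \<le> e * norm (y - y')"
      using sd[OF e] by metis
    define \<delta> where "\<delta> = Min (range d)"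
    have \<delta>: "\<delta> > 0" "\<And>i. \<delta> \<le> d i" using d(1) by (auto simp: \<delta>_def)
    have "norm (g y - g y' - (\<chi> i. A i (y - y'))) \<le> \<epsilon> * norm (y - y')"
      if "norm (y - x) < \<delta>" "norm (y' - x) < \<delta>" for y y'
    proof -
      have "norm (g y - g y' - (\<chi> i. A i (y - y'))) \<le> (\<Sum>i\<in>UNIV. \<bar>(g y - g y' - (\<chi> i. A i (y - y'))) $ i\<bar>)"
        by (rule norm_le_l1_cart)
      also have "\<dots> \<le> (\<Sum>i\<in>(UNIV :: 'm set). e * norm (y - y'))"
        using that \<delta>(2) by (intro sum_mono) (simp, meson d(2) less_le_trans)
      also have "\<dots> = \<epsilon> * norm (y - y')" by (simp add: e_def)
      finally show ?thesis .
    qed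
    with \<delta>(1) show "\<exists>\<delta>>0. \<forall>y y'. norm (y - x) < \<delta> \<longrightarrow> norm (y' - x) < \<delta> \<longrightarrow>
        norm (g y - g y' - (\<chi> i. A i (y - y'))) \<le> \<epsilon> * norm (y - y')" by blast
  qed
qed

lemma strictly_differentiable_imp_has_derivative:
  fixes g :: "real ^ 'n \<Rightarrow> real ^ 'm"
  assumes A: "linear A"
    and sd: "\<And>\<epsilon>. \<epsilon> > 0 \<Longrightarrow> \<exists>\<delta>>0. \<forall>y y'. norm (y - x) < \<delta> \<longrightarrow> norm (y' - x) < \<delta> \<longrightarrow>
        norm (g y - g y' - A (y - y')) \<le> \<epsilon> * norm (y - y')"
  shows "(g has_derivative A) (at x)"
  unfolding has_derivative_within_alt
proof (intro conjI allI impI)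
  show "bounded_linear A" using A by (simp add: linear_conv_bounded_linear)
  fix e :: real assume "e > 0"
  from sd[OF this] obtain \<delta> where "\<delta> > 0" "\<And>y y'. norm (y - x) < \<delta> \<Longrightarrow> norm (y' - x) < \<delta> \<Longrightarrow>
        norm (g y - g y' - A (y - y')) \<le> e * norm (y - y')" by blast
  then show "\<exists>d>0. \<forall>y\<in>UNIV. norm (y - x) < d \<longrightarrow> norm (g y - g x - A (y - x)) \<le> e * norm (y - x)"
    by (intro exI[of _ \<delta>]) simp
qed

text \<open>\<open>O1\<close> is the largest open set whose trace on \<open>Y\<close> lies in the
  hyperplane, \<open>O2\<close> the largest open set that misses this trace. In a chart, points of
  \<open>Y\<close> are joined by segments inside a ball of \<open>W\<close>, so by the identity
  theorem a patch that meets the trace lies entirely in the hyperplane. Hence \<open>O1\<close> and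
  \<open>O2\<close> cover \<open>Y\<close>, and connectedness decides for \<open>O2\<close>.\<close>

lemma submanifold_not_locally_in_hyperplane:
  fixes Y :: "(real ^ 'n) set"
  assumes Y: "real_analytic_submanifold d Y" "connected Y" and not: "\<not> Y \<subseteq> {x. a \<bullet> x = b}"
    and y: "y \<in> Y" and e: "e > 0"
  obtains y' where "y' \<in> Y" "dist y' y < e" "a \<bullet> y' \<noteq> b"
proof -
  define O1 where "O1 = \<Union>{S. open S \<and> S \<inter> Y \<subseteq> {x. a \<bullet> x = b}}"
  have O1: "open O1" "O1 \<inter> Y \<subseteq> {x. a \<bullet> x = b}" unfolding O1_def by auto
  have O1I: "z \<in> O1" if "open S" "S \<inter> Y \<subseteq> {x. a \<bullet> x = b}" "z \<in> S" for S z
    unfolding O1_def using that by blast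
  define O2 where "O2 = \<Union>{S. open S \<and> S \<inter> (O1 \<inter> Y) = {}}"
  have O2: "open O2" "O2 \<inter> O1 \<inter> Y = {}" unfolding O2_def by auto
  have cover: "z \<in> O1 \<union> O2" if z: "z \<in> Y" for z
  proof -
    obtain U V :: "(real ^ 'n) set" and \<phi> \<psi> W where ch: "z \<in> U" "homeomorphism U V \<phi> \<psi>"
      "\<phi> real_analytic_on U" "\<psi> real_analytic_on V" "subspace W" "\<phi> ` (U \<inter> Y) = V \<inter> W"
      using Y(1)[unfolded real_analytic_submanifold_def, rule_format, OF z] by blast
    have op: "open U" "open V" using ch real_analytic_on_open by blast+
    have hom: "continuous_on U \<phi>" "continuous_on V \<psi>" "\<And>u. u \<in> U \<Longrightarrow> \<psi> (\<phi> u) = u"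
      "\<And>v. v \<in> V \<Longrightarrow> \<phi> (\<psi> v) = v" "\<phi> ` U = V" "\<psi> ` V = U"
      using ch(2) by (auto simp: homeomorphism_def)
    have \<psi>Y: "\<psi> w \<in> Y" if "w \<in> V" "w \<in> W" for w
    proof -
      have "w \<in> \<phi> ` (U \<inter> Y)" using that ch(6) by blast
      then show ?thesis using hom(3) by auto
    qed
    have "\<phi> z \<in> V" using ch(1) hom(5) by blast
    then obtain r where r: "r > 0" "ball (\<phi> z) r \<subseteq> V" using op(2) openE by blast
    define N where "N = U \<inter> \<phi> -` ball (\<phi> z) r"
    have N: "open N" "z \<in> N"
      using continuous_open_preimage[OF hom(1) op(1) open_ball] ch(1) r(1) by (auto simp: N_def)
    show ?thesis
    proof (cases "N \<inter> (O1 \<inter> Y) = {}")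
      case True
      then have "z \<in> O2" unfolding O2_def using N by blast
      then show ?thesis by simp
    next
      case False
      then obtain y1 where y1: "y1 \<in> N" "y1 \<in> O1" "y1 \<in> Y" by blast
      define w1 where "w1 = \<phi> y1"
      have w1: "w1 \<in> ball (\<phi> z) r" "w1 \<in> W" "\<psi> w1 = y1"
        using y1 hom(3) ch(6) by (auto simp: w1_def N_def)
      have "open (V \<inter> \<psi> -` O1)" by (rule continuous_open_preimage[OF hom(2) op(2) O1(1)])
      moreover have "w1 \<in> V \<inter> \<psi> -` O1" using w1 y1 r by auto
      ultimately obtain e1 where e1: "e1 > 0" "ball w1 e1 \<subseteq> V \<inter> \<psi> -` O1" using openE by blast
      have "a \<bullet> y2 = b" if y2: "y2 \<in> N" "y2 \<in> Y" for y2
      proof -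
        define w2 where "w2 = \<phi> y2"
        have w2: "w2 \<in> ball (\<phi> z) r" "w2 \<in> W" "\<psi> w2 = y2"
          using y2 hom(3) ch(6) by (auto simp: w2_def N_def)
        let ?h = "\<lambda>v. a \<bullet> \<psi> v - b"
        have "?h (w1 + (w2 - w1)) = 0"
        proof (rule analytic_line_identity)
          fix t :: real assume "0 \<le> t" "t \<le> 1"
          then have "(1 - t) *\<^sub>R w1 + t *\<^sub>R w2 \<in> ball (\<phi> z) r"
            using convexD[OF convex_ball w1(1) w2(1), of "1 - t" t] by simp
          then have "w1 + t *\<^sub>R (w2 - w1) \<in> V" using r by (auto simp: algebra_simps)
          then show "analytic_at ?h (w1 + t *\<^sub>R (w2 - w1))"
            by (rule real_analytic_on_imp_analytic_at[OF ch(4)])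
        next
          \<comment> \<open>The summand 1 covers the case \<open>w2 = w1\<close>.\<close>
          show "e1 / (norm (w2 - w1) + 1) > 0" using e1 by (simp add: add_nonneg_pos)
          fix t :: real assume t: "\<bar>t\<bar> < e1 / (norm (w2 - w1) + 1)"
          have "\<bar>t\<bar> * norm (w2 - w1) \<le> \<bar>t\<bar> * (norm (w2 - w1) + 1)" by (simp add: mult_left_mono)
          also have "\<dots> < e1" using t by (simp add: pos_less_divide_eq add_nonneg_pos)
          finally have "w1 + t *\<^sub>R (w2 - w1) \<in> ball w1 e1" by (simp add: dist_norm)
          then have "w1 + t *\<^sub>R (w2 - w1) \<in> V" "\<psi> (w1 + t *\<^sub>R (w2 - w1)) \<in> O1" using e1 by auto
          moreover have "w1 + t *\<^sub>R (w2 - w1) \<in> W"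
            using w1 w2 ch(5) by (simp add: subspace_add subspace_scale subspace_diff)
          ultimately show "?h (w1 + t *\<^sub>R (w2 - w1)) = 0" using O1(2) \<psi>Y by force
        qed
        then show ?thesis using w2 by simp
      qed
      then have "z \<in> O1" by (intro O1I[OF N(1) _ N(2)]) blast
      then show ?thesis by simp
    qed
  qed
  have "O1 \<inter> Y = {}"
  proof (rule ccontr)
    assume "O1 \<inter> Y \<noteq> {}"
    then have "O2 \<inter> Y = {}"
      using connectedD[OF Y(2) O1(1) O2(1)] O2(2) cover by blast
    then show False using cover O1(2) not by blast
  qed
  then have "\<not> ball y e \<inter> Y \<subseteq> {x. a \<bullet> x = b}" using O1I[OF open_ball, of y e y] y e by auto
  then obtain y' where "y' \<in> ball y e" "y' \<in> Y" "a \<bullet> y' \<noteq> b" by blast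
  then show ?thesis using that by (simp add: dist_commute)
qed

section \<open>Linear algebra for a transversal coordinate subspace\<close>

lemma linear_complement_data:
  fixes A :: "real ^ 'n \<Rightarrow> real ^ 'n"
  assumes A: "linear A" and inj: "inj_on A W" and W: "subspace W" "dim W = d"
  obtains P M and J :: "'n set" where "linear P" "linear M" "inj M" "\<And>v. P v \<in> W"
    "\<And>w. w \<in> W \<Longrightarrow> P w = w" "\<And>w. w \<in> W \<Longrightarrow> M w = A w"
    "\<And>v i. i \<notin> J \<Longrightarrow> M (v - P v) $ i = 0" "card J + d = CARD('n)"
proof -
  obtain B where B: "B \<subseteq> W" "independent B" "W \<subseteq> span B" "card B = d"
    using basis_exists[of W] W(2) by metis
  have WB: "span B = W" using B W(1) by (metis span_subspace)
  have indAB: "independent (A ` B)"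
    using linear_independent_injective_image[OF A B(2)] inj WB by simp
  obtain B' where B': "B \<subseteq> B'" "independent B'" "UNIV \<subseteq> span B'"
    using maximal_independent_subset_extend[OF _ B(2), of UNIV] by auto
  obtain D where D: "A ` B \<subseteq> D" "D \<subseteq> A ` B \<union> Basis" "independent D" "A ` B \<union> Basis \<subseteq> span D"
    using maximal_independent_subset_extend[OF Un_upper1 indAB] by metis
  have spD: "span D = UNIV"
    using D(4) by (metis Un_subset_iff span_Basis span_mono span_span top.extremum_uniqueI)
  have fin: "finite B'" "finite D" "finite B"
    using B' D B independent_imp_finite by blast+
  have cB': "card B' = CARD('n)"
    using B' dim_eq_card_independent[OF B'(2)] by (metis DIM_cart DIM_real dim_UNIV dim_span mult.right_neutral top.extremum_uniqueI)
  have cD: "card D = CARD('n)"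
    using spD dim_eq_card_independent[OF D(3)] by (metis DIM_cart DIM_real dim_UNIV dim_span mult.right_neutral)
  have injB: "inj_on A B" using inj B(1) inj_on_subset by blast
  have cAB: "card (A ` B) = d" using card_image[OF injB] B(4) by simp
  have c1: "card (B' - B) = CARD('n) - d" using card_Diff_subset[OF fin(3) B'(1)] cB' B(4) by simp
  have c2: "card (D - A ` B) = CARD('n) - d" using card_Diff_subset[OF _ D(1)] fin(3) cD cAB by simp
  have dn: "d \<le> CARD('n)" using card_mono[OF fin(1) B'(1)] cB' B(4) by simp
  obtain \<beta> where \<beta>: "bij_betw \<beta> (B' - B) (D - A ` B)"
    using finite_same_card_bij[of "B' - B" "D - A ` B"] fin c1 c2 by auto
  obtain M where M: "linear M" "\<And>b. b \<in> B' \<Longrightarrow> M b = (if b \<in> B then A b else \<beta> b)"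
    using linear_independent_extend[OF B'(2), of "\<lambda>b. if b \<in> B then A b else \<beta> b"] by blast
  obtain P :: "real ^ 'n \<Rightarrow> real ^ 'n" where P: "linear P" "\<And>b. b \<in> B' \<Longrightarrow> P b = (if b \<in> B then b else 0)"
    using linear_independent_extend[OF B'(2), of "\<lambda>b. if b \<in> B then b else 0"] by blast
  define J where "J = {j. axis j 1 \<in> D - A ` B}"
  have BP: "P x = x" and BM: "M x = A x" if "x \<in> B" for x
    using P(2)[of x] M(2)[of x] B'(1) that by auto
  have PW: "P w = w" if "w \<in> W" for w
    using linear_eq_on_span[OF P(1) linear_id, of B w] BP WB that by auto
  have MW: "M w = A w" if "w \<in> W" for w
    using linear_eq_on_span[OF M(1) A, of B w] BM WB that by auto
  have PinW: "P v \<in> W" for v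
  proof -
    have "v \<in> span B'" using B'(3) by auto
    then show ?thesis
      by (induction rule: span_induct_alt)
        (auto simp: linear_0[OF P(1)] linear_add[OF P(1)] linear_cmul[OF P(1)] P(2)
          intro!: subspace_add subspace_scale subspace_0 W(1) dest: subsetD[OF B(1)])
  qed
  have MJ: "M (v - P v) $ i = 0" if i: "i \<notin> J" for v i
  proof -
    have "v \<in> span B'" using B'(3) by auto
    then show ?thesis
    proof (induction rule: span_induct_alt)
      case base
      then show ?case by (simp add: linear_0[OF P(1)] linear_0[OF M(1)])
    next
      case (step c x y)
      have x: "M (x - P x) $ i = 0"
      proof (cases "x \<in> B")
        case True
        then show ?thesis using P(2) B'(1) by (auto simp: linear_0[OF M(1)])
      next
        case False
        then have "M (x - P x) = \<beta> x" "\<beta> x \<in> D - A ` B"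
          using step(1) P(2) M(2) bij_betwE[OF \<beta>] by auto
        moreover obtain j where j: "\<beta> x = axis j 1"
          using calculation(2) D(2) by (auto simp: Basis_vec_def)
        ultimately have "j \<noteq> i" using i by (auto simp: J_def)
        then show ?thesis using \<open>M (x - P x) = \<beta> x\<close> j by (simp add: axis_def)
      qed
      have "M (c *\<^sub>R x + y - P (c *\<^sub>R x + y)) = M (c *\<^sub>R (x - P x) + (y - P y))"
        by (simp add: linear_add[OF P(1)] linear_cmul[OF P(1)] algebra_simps)
      also have "\<dots> = c *\<^sub>R M (x - P x) + M (y - P y)"
        by (simp only: linear_add[OF M(1)] linear_cmul[OF M(1)])
      finally show ?case using x step(2) by simp
    qed
  qed
  have cJ: "card J = CARD('n) - d"
  proof -
    have "(\<lambda>j. axis j (1::real)) ` J = D - A ` B"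
      using D(2) by (auto simp: J_def Basis_vec_def)
    moreover have "inj_on (\<lambda>j. axis j (1::real) :: real ^ 'n) J"
      by (auto simp: inj_on_def axis_eq_axis)
    ultimately show ?thesis using card_image[of "\<lambda>j. axis j (1::real) :: real ^ 'n" J] c2 by simp
  qed
  have "surj M"
  proof -
    have "D \<subseteq> range M"
    proof
      fix x assume x: "x \<in> D"
      show "x \<in> range M"
      proof (cases "x \<in> A ` B")
        case True
        then obtain b where "b \<in> B" "x = A b" by blast
        then show ?thesis using BM[of b] by (metis rangeI)
      next
        case False
        then obtain b where "b \<in> B' - B" "x = \<beta> b"
          using x bij_betw_imp_surj_on[OF \<beta>] by blast
        then have "x = M b" using M(2)[of b] by simp
        then show ?thesis by simp
      qed
    qed
    then have "span D \<subseteq> range M"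
      using span_minimal linear_subspace_image[OF M(1) subspace_UNIV] by blast
    then show ?thesis using spD by auto
  qed
  then have "inj M" by (rule linear_surjective_imp_injective[OF M(1)]) simp
  show ?thesis
    by (rule that[OF P(1) M(1) \<open>inj M\<close> PinW PW MW MJ]) (use cJ dn in auto)
qed

section \<open>Sections over a transversal coordinate subspace\<close>

lemma strictly_differentiable_lower_bound:
  fixes g :: "real ^ 'n \<Rightarrow> real ^ 'm"
  assumes A: "linear A" "inj A"
    and sd: "\<And>\<epsilon>. \<epsilon> > 0 \<Longrightarrow> \<exists>\<delta>>0. \<forall>y y'. norm (y - x) < \<delta> \<longrightarrow> norm (y' - x) < \<delta> \<longrightarrow>
        norm (g y - g y' - A (y - y')) \<le> \<epsilon> * norm (y - y')"
  obtains c \<delta> where "c > 0" "\<delta> > 0"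
    "\<And>y y'. norm (y - x) < \<delta> \<Longrightarrow> norm (y' - x) < \<delta> \<Longrightarrow> c * norm (y - y') \<le> norm (g y - g y')"
proof -
  obtain c where c: "c > 0" "\<And>v. c * norm v \<le> norm (A v)"
    using linear_inj_bounded_below_pos[OF A] by metis
  obtain \<delta> where \<delta>: "\<delta> > 0" "\<And>y y'. norm (y - x) < \<delta> \<Longrightarrow> norm (y' - x) < \<delta> \<Longrightarrow>
        norm (g y - g y' - A (y - y')) \<le> c / 2 * norm (y - y')"
    using sd[of "c / 2"] c by auto
  have "c / 2 * norm (y - y') \<le> norm (g y - g y')" if "norm (y - x) < \<delta>" "norm (y' - x) < \<delta>" for y y'
  proof -
    have "norm (A (y - y')) \<le> norm (g y - g y') + norm (g y - g y' - A (y - y'))"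
      by (metis norm_minus_commute norm_triangle_sub)
    then show ?thesis using c(2)[of "y - y'"] \<delta>(2)[OF that] by (simp add: field_simps)
  qed
  then show ?thesis using that[of "c / 2" \<delta>] c \<delta> by simp
qed

text \<open>The two-point bound near one base point thus makes the derivative injective at every
  point of the neighbourhood, with no appeal to continuity of the derivative.\<close>

lemma has_derivative_lower_bound_inj:
  fixes g :: "'a::real_normed_vector \<Rightarrow> 'b::real_normed_vector"
  assumes g: "(g has_derivative g') (at x)" and c: "c > 0" and \<delta>: "\<delta> > 0"
    and lb: "\<And>y. norm (y - x) < \<delta> \<Longrightarrow> c * norm (y - x) \<le> norm (g y - g x)"
  shows "inj g'"
proof -
  have lin: "linear g'" using g has_derivative_linear by blast
  have "v = 0" if v: "g' v = 0" for v
  proof (rule ccontr)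
    assume "v \<noteq> 0"
    obtain d where d: "d > 0" "\<And>y. norm (y - x) < d \<Longrightarrow> norm (g y - g x - g' (y - x)) \<le> c / 2 * norm (y - x)"
      using g[unfolded has_derivative_within_alt] c by (metis UNIV_I half_gt_zero)
    define t where "t = min d \<delta> / 2 / norm v"
    have t: "t > 0" "t * norm v < d" "t * norm v < \<delta>"
      using d \<delta> \<open>v \<noteq> 0\<close> by (auto simp: t_def min_def)
    have "norm (g (x + t *\<^sub>R v) - g x) \<le> c / 2 * (t * norm v)"
      using d(2)[of "x + t *\<^sub>R v"] t v by (simp add: linear_cmul[OF lin])
    moreover have "c * (t * norm v) \<le> norm (g (x + t *\<^sub>R v) - g x)"
      using lb[of "x + t *\<^sub>R v"] t by simp
    moreover have "c * (t * norm v) > 0" using c t \<open>v \<noteq> 0\<close> by simp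
    ultimately show False by simp
  qed
  then show ?thesis using linear_injective_0[OF lin] by blast
qed

lemma rational_approximation_vec:
  fixes x :: "real ^ 'n"
  assumes "e > 0"
  obtains q where "\<And>i. q $ i \<in> \<rat>" "norm (q - x) < e"
proof -
  define e' where "e' = e / (real CARD('n) + 1)"
  have e': "e' > 0" using assms by (simp add: e'_def)
  have "\<exists>r\<in>\<rat>. \<bar>r - x $ i\<bar> < e'" for i
  proof -
    obtain r where "r \<in> \<rat>" "x $ i - e' < r" "r < x $ i + e'"
      using Rats_dense_in_real[of "x $ i - e'" "x $ i + e'"] e' by auto
    then show ?thesis by (intro bexI[of _ r]) auto
  qed
  then obtain r where r: "\<And>i. r i \<in> \<rat>" "\<And>i. \<bar>r i - x $ i\<bar> < e'" by metis
  have "norm ((\<chi> i. r i) - x) \<le> (\<Sum>i\<in>UNIV. \<bar>((\<chi> i. r i) - x) $ i\<bar>)" by (rule norm_le_l1_cart)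
  also have "\<dots> \<le> (\<Sum>i\<in>(UNIV :: 'n set). e')"
    using r(2) by (intro sum_mono) (simp add: less_imp_le)
  also have "\<dots> < e" using assms by (simp add: e'_def field_simps)
  finally show ?thesis using that[of "\<chi> i. r i"] r(1) by simp
qed

text \<open>The parameter \<open>u\<close> ranges over the ambient space, where rationality has a
  meaning and no type of dimension \<open>d\<close> is required. The last clause is the escape
  property: from any \<open>u\<close>, some rational direction leaves a given hyperplane
  immediately, and every short step along it stays off.\<close>

lemma local_section:
  fixes Y :: "(real ^ 'n) set"
  assumes Y: "real_analytic_submanifold d Y" "connected Y" and y0: "y0 \<in> Y"
  obtains s R and J :: "'n set" where "R > 0" "card J + d = CARD('n)"
    "continuous_on (ball y0 R) s" "s y0 = y0"
    "\<And>u. u \<in> ball y0 R \<Longrightarrow> s u \<in> Y"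
    "\<And>u i. u \<in> ball y0 R \<Longrightarrow> i \<notin> J \<Longrightarrow> s u $ i = u $ i"
    "\<And>u a b. u \<in> ball y0 R \<Longrightarrow> \<not> Y \<subseteq> {x. a \<bullet> x = b} \<Longrightarrow>
       \<exists>\<theta>. (\<forall>i. \<theta> $ i \<in> \<rat>) \<and> (\<exists>\<delta>>0. \<forall>t. 0 < t \<and> t < \<delta> \<longrightarrow> a \<bullet> s (u + t *\<^sub>R \<theta>) \<noteq> b)"
proof -
  obtain U V :: "(real ^ 'n) set" and \<phi> \<psi> W where ch: "y0 \<in> U" "homeomorphism U V \<phi> \<psi>"
    "\<phi> real_analytic_on U" "\<psi> real_analytic_on V" "subspace W" "dim W = d" "\<phi> ` (U \<inter> Y) = V \<inter> W"
    using Y(1)[unfolded real_analytic_submanifold_def, rule_format, OF y0] by blast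
  have op: "open U" "open V" using ch real_analytic_on_open by blast+
  have hom: "continuous_on U \<phi>" "continuous_on V \<psi>" "\<And>u. u \<in> U \<Longrightarrow> \<psi> (\<phi> u) = u"
    "\<And>v. v \<in> V \<Longrightarrow> \<phi> (\<psi> v) = v" "\<phi> ` U = V" "\<psi> ` V = U"
    using ch(2) by (auto simp: homeomorphism_def)
  have \<psi>Y: "\<psi> w \<in> Y" if "w \<in> V" "w \<in> W" for w
  proof -
    have "w \<in> \<phi> ` (U \<inter> Y)" using that ch(7) by blast
    then show ?thesis using hom(3) by auto
  qed
  define w0 where "w0 = \<phi> y0"
  have w0: "w0 \<in> V" "w0 \<in> W" "\<psi> w0 = y0" using ch y0 hom(3,5) by (auto simp: w0_def)
  obtain A where A: "linear A"
    and sd\<psi>: "\<And>\<epsilon>. \<epsilon> > 0 \<Longrightarrow> \<exists>\<delta>>0. \<forall>y y'. norm (y - w0) < \<delta> \<longrightarrow> norm (y' - w0) < \<delta> \<longrightarrow>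
        norm (\<psi> y - \<psi> y' - A (y - y')) \<le> \<epsilon> * norm (y - y')"
    by (rule real_analytic_strictly_differentiable[OF ch(4) w0(1)]) (rule that)
  have "inj A"
  proof -
    have dA: "(\<psi> has_derivative A) (at w0)"
      by (rule strictly_differentiable_imp_has_derivative[OF A sd\<psi>])
    obtain A' where A': "linear A'"
      and sd\<phi>: "\<And>\<epsilon>. \<epsilon> > 0 \<Longrightarrow> \<exists>\<delta>>0. \<forall>y y'. norm (y - y0) < \<delta> \<longrightarrow> norm (y' - y0) < \<delta> \<longrightarrow>
          norm (\<phi> y - \<phi> y' - A' (y - y')) \<le> \<epsilon> * norm (y - y')"
      by (rule real_analytic_strictly_differentiable[OF ch(3,1)]) (rule that)
    have "(\<phi> has_derivative A') (at (\<psi> w0))"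
      unfolding w0(3) by (rule strictly_differentiable_imp_has_derivative[OF A' sd\<phi>])
    then have "(\<phi> \<circ> \<psi> has_derivative A' \<circ> A) (at w0)" by (rule diff_chain_at[OF dA])
    then have "((\<lambda>v. v) has_derivative A' \<circ> A) (at w0)"
      by (rule has_derivative_transform_within_open[OF _ op(2) w0(1)]) (simp add: hom)
    then have "A' \<circ> A = (\<lambda>v. v)" using has_derivative_unique has_derivative_ident by blast
    then show "inj A" by (metis inj_on_id2 inj_on_imageI2)
  qed
  then have injW: "inj_on A W" by (rule inj_on_subset) simp
  obtain P M and J :: "'n set" where PM: "linear P" "linear M" "inj M" and PW: "\<And>v. P v \<in> W"
    "\<And>w. w \<in> W \<Longrightarrow> P w = w" and MA: "\<And>w. w \<in> W \<Longrightarrow> M w = A w"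
    and MJ: "\<And>v i. i \<notin> J \<Longrightarrow> M (v - P v) $ i = 0" and cJ: "card J + d = CARD('n)"
    by (rule linear_complement_data[OF A injW ch(5,6)]) (rule that)
  have Pw0: "P w0 = w0" using PW(2) w0(2) .
  obtain KP where KP: "KP > 0" "\<And>v. norm (P v) \<le> KP * norm v"
    using linear_bounded_pos[OF PM(1)] by metis
  \<comment> \<open>As \<open>M = A\<close> on \<open>W\<close>, the derivative of \<open>G\<close> at \<open>w0\<close> is the invertible map \<open>M\<close>; moreover \<open>G v\<close> and
    \<open>\<psi> (P v) \<in> Y\<close> differ only in the coordinates in \<open>J\<close>.\<close>
  define G where "G v = \<psi> (P v) + M (v - P v)" for v
  have sdG: "\<exists>\<delta>>0. \<forall>y y'. norm (y - w0) < \<delta> \<longrightarrow> norm (y' - w0) < \<delta> \<longrightarrow>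
        norm (G y - G y' - M (y - y')) \<le> \<epsilon> * norm (y - y')" if \<epsilon>: "\<epsilon> > 0" for \<epsilon>
  proof -
    obtain \<delta> where \<delta>: "\<delta> > 0" "\<And>y y'. norm (y - w0) < \<delta> \<Longrightarrow> norm (y' - w0) < \<delta> \<Longrightarrow>
        norm (\<psi> y - \<psi> y' - A (y - y')) \<le> \<epsilon> / KP * norm (y - y')"
      using sd\<psi>[of "\<epsilon> / KP"] \<epsilon> KP(1) by auto
    have Pd: "norm (P y - w0) < \<delta>" if "norm (y - w0) < \<delta> / KP" for y
    proof -
      have "norm (P y - w0) \<le> KP * norm (y - w0)"
        using KP(2)[of "y - w0"] by (simp add: linear_diff[OF PM(1)] Pw0)
      also have "\<dots> < \<delta>" using that KP(1) by (simp add: field_simps)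
      finally show ?thesis .
    qed
    have "norm (G y - G y' - M (y - y')) \<le> \<epsilon> * norm (y - y')"
      if "norm (y - w0) < \<delta> / KP" "norm (y' - w0) < \<delta> / KP" for y y'
    proof -
      have "G y - G y' - M (y - y') = \<psi> (P y) - \<psi> (P y') - M (P (y - y'))"
        by (simp add: G_def linear_diff[OF PM(1)] linear_diff[OF PM(2)] algebra_simps)
      also have "M (P (y - y')) = A (P y - P y')" using MA[OF PW(1), of "y - y'"] by (simp add: linear_diff[OF PM(1)])
      also have "norm (\<psi> (P y) - \<psi> (P y') - A (P y - P y')) \<le> \<epsilon> / KP * norm (P y - P y')"
        by (rule \<delta>(2)[OF Pd Pd]) (rule that)+
      also have "\<dots> \<le> \<epsilon> / KP * (KP * norm (y - y'))"
        using KP \<epsilon> by (intro mult_left_mono) (simp_all flip: linear_diff[OF PM(1)])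
      finally show ?thesis using KP(1) by simp
    qed
    moreover have "\<delta> / KP > 0" using \<delta> KP by simp
    ultimately show ?thesis by blast
  qed
  obtain c \<delta>1 where c: "c > 0" "\<delta>1 > 0" and
    lb1: "\<And>y y'. norm (y - w0) < \<delta>1 \<Longrightarrow> norm (y' - w0) < \<delta>1 \<Longrightarrow> c * norm (y - y') \<le> norm (G y - G y')"
    by (rule strictly_differentiable_lower_bound[OF PM(2,3) sdG], assumption) (rule that)
  have contP: "continuous_on S P" for S by (rule linear_continuous_on[OF linear_conv_bounded_linear[THEN iffD1, OF PM(1)]])
  have contM: "continuous_on S M" for S by (rule linear_continuous_on[OF linear_conv_bounded_linear[THEN iffD1, OF PM(2)]])
  have "open (P -` V)" using open_vimage[OF op(2) contP] .
  then obtain \<delta>2 where \<delta>2: "\<delta>2 > 0" "ball w0 \<delta>2 \<subseteq> P -` V" using w0(1) Pw0 openE by (metis vimageI2)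
  define \<delta> where "\<delta> = min \<delta>1 \<delta>2"
  define D where "D = ball w0 \<delta>"
  have D: "open D" "w0 \<in> D" "\<And>v. v \<in> D \<Longrightarrow> P v \<in> V"
    using c \<delta>2 by (auto simp: D_def \<delta>_def)
  have lb: "c * norm (y - y') \<le> norm (G y - G y')" if "y \<in> D" "y' \<in> D" for y y'
    using lb1 that by (simp add: D_def \<delta>_def dist_norm norm_minus_commute)
  have injG: "inj_on G D"
  proof (rule inj_onI)
    fix y y' assume "y \<in> D" "y' \<in> D" "G y = G y'"
    then have "c * norm (y - y') \<le> 0" using lb[of y y'] by simp
    then show "y = y'" using c(1) by (simp add: mult_le_0_iff)
  qed
  have contG: "continuous_on D G"
    unfolding G_def
    by (intro continuous_intros continuous_on_compose2[OF hom(2) contP] continuous_on_compose2[OF contM] contP)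
      (use D(3) in auto)
  \<comment> \<open>Invariance of domain supplies openness of the image, and \<open>lb\<close> makes
    the inverse Lipschitz.\<close>
  have opG: "open (G ` D)" by (rule invariance_of_domain[OF contG D(1) injG])
  have Gw0: "G w0 = y0" by (simp add: G_def Pw0 w0(3) linear_0[OF PM(2)])
  obtain R where R: "R > 0" "ball y0 R \<subseteq> G ` D" using opG D(2) Gw0 openE by (metis imageI)
  define g where "g = inv_into D G"
  have g: "g u \<in> D" "G (g u) = u" if "u \<in> ball y0 R" for u
    using that R(2) f_inv_into_f[of u G D] inv_into_into[of u G D] by (auto simp: g_def)
  have gw0: "g y0 = w0" using inv_into_f_f[OF injG D(2)] Gw0 by (simp add: g_def)
  have contg: "continuous_on (ball y0 R) g"
  proof (rule continuous_onI)
    fix u e assume u: "u \<in> ball y0 R" and e: "(e::real) > 0"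
    show "\<exists>d>0. \<forall>u'\<in>ball y0 R. dist u' u < d \<longrightarrow> dist (g u') (g u) \<le> e"
    proof (intro exI[of _ "c * e"] conjI ballI impI)
      show "c * e > 0" using c e by simp
      fix u' assume u': "u' \<in> ball y0 R" "dist u' u < c * e"
      have "c * dist (g u') (g u) \<le> dist u' u"
        using lb[OF g(1)[OF u'(1)] g(1)[OF u]] g(2)[OF u'(1)] g(2)[OF u] by (simp add: dist_norm)
      then have "c * dist (g u') (g u) < c * e" using u' by simp
      then show "dist (g u') (g u) \<le> e" using c(1) by simp
    qed
  qed
  define s where "s u = \<psi> (P (g u))" for u
  have Vg: "P (g u) \<in> V" if "u \<in> ball y0 R" for u using D(3) g(1)[OF that] .
  have conts: "continuous_on (ball y0 R) s"
    unfolding s_def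
    by (rule continuous_on_compose2[OF hom(2) continuous_on_compose2[OF contP contg]]) (use Vg in auto)
  have s0: "s y0 = y0" by (simp add: s_def gw0 Pw0 w0(3))
  have sJ: "s u $ i = u $ i" if u: "u \<in> ball y0 R" and i: "i \<notin> J" for u i
  proof -
    have "u = s u + M (g u - P (g u))" using g(2)[OF u] by (simp add: G_def s_def)
    then have "u $ i = s u $ i + M (g u - P (g u)) $ i" by (metis vector_add_component)
    then show ?thesis using MJ[OF i] by simp
  qed
  have escape: "\<exists>\<theta>. (\<forall>i. \<theta> $ i \<in> \<rat>) \<and> (\<exists>\<delta>>0. \<forall>t. 0 < t \<and> t < \<delta> \<longrightarrow> a \<bullet> s (u + t *\<^sub>R \<theta>) \<noteq> b)"
    if u: "u \<in> ball y0 R" and ab: "\<not> Y \<subseteq> {x. a \<bullet> x = b}" for u a b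
  proof -
    define v w where "v = g u" and "w = P v"
    have v: "v \<in> D" and w: "w \<in> V" "w \<in> W" using g(1)[OF u] Vg[OF u] PW by (auto simp: v_def w_def)
    let ?h = "\<lambda>v. a \<bullet> \<psi> v - b"
    \<comment> \<open>Since \<open>Y\<close> is nowhere locally inside the hyperplane,
      \<open>?h\<close> does not vanish identically on \<open>W\<close> near
      \<open>w\<close>.\<close>
    have nz: "\<exists>z\<in>W. norm z < e \<and> ?h (w + z) \<noteq> 0" if e: "e > 0" for e
    proof -
      have \<psi>w: "\<psi> w \<in> U" "\<psi> w \<in> Y" "\<phi> (\<psi> w) = w" using w \<psi>Y hom(4,6) by auto
      have "open (U \<inter> \<phi> -` ball w e)" by (rule continuous_open_preimage[OF hom(1) op(1) open_ball])
      moreover have "\<psi> w \<in> U \<inter> \<phi> -` ball w e" using \<psi>w e by simp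
      ultimately obtain e' where e': "e' > 0" "ball (\<psi> w) e' \<subseteq> U \<inter> \<phi> -` ball w e" using openE by blast
      obtain y' where y': "y' \<in> Y" "dist y' (\<psi> w) < e'" "a \<bullet> y' \<noteq> b"
        by (rule submanifold_not_locally_in_hyperplane[OF Y ab \<psi>w(2) e'(1)])
      have "y' \<in> ball (\<psi> w) e'" using y'(2) by (simp add: dist_commute)
      then have *: "y' \<in> U" "\<phi> y' \<in> ball w e" using e'(2) by auto
      then have "\<phi> y' \<in> W" using y'(1) ch(7) by blast
      then show ?thesis
        using * y'(3) hom(3) w(2) ch(5)
        by (intro bexI[of _ "\<phi> y' - w"]) (auto simp: dist_norm norm_minus_commute subspace_diff)
    qed
    obtain z \<epsilon> \<delta>0 where z: "z \<in> W" "\<epsilon> > 0" "\<delta>0 > 0" and cone: "\<And>z' t. z' \<in> W \<Longrightarrow>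
        norm (z' - z) < \<epsilon> \<Longrightarrow> 0 < \<bar>t\<bar> \<Longrightarrow> \<bar>t\<bar> < \<delta>0 \<Longrightarrow> ?h (w + t *\<^sub>R z') \<noteq> 0"
      by (rule analytic_nonzero_on_cone[OF real_analytic_on_imp_analytic_at[OF ch(4) w(1)] ch(5) nz], assumption)
        (rule that)
    obtain G' where G': "(G has_derivative G') (at v)"
    proof -
      obtain A' where A': "linear A'"
        and sd: "\<And>\<epsilon>. \<epsilon> > 0 \<Longrightarrow> \<exists>\<delta>>0. \<forall>y y'. norm (y - w) < \<delta> \<longrightarrow> norm (y' - w) < \<delta> \<longrightarrow>
            norm (\<psi> y - \<psi> y' - A' (y - y')) \<le> \<epsilon> * norm (y - y')"
        by (rule real_analytic_strictly_differentiable[OF ch(4) w(1)]) (rule that)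
      have "(\<psi> has_derivative A') (at (P v))"
        using strictly_differentiable_imp_has_derivative[OF A' sd] unfolding w_def .
      from has_derivative_compose[OF linear_imp_has_derivative[OF PM(1)] this]
      have "((\<lambda>x. \<psi> (P x)) has_derivative (\<lambda>x. A' (P x))) (at v)" .
      moreover have "((\<lambda>x. M (x - P x)) has_derivative (\<lambda>x. M (x - P x))) (at v)"
        by (rule linear_imp_has_derivative)
          (intro linear_compose[OF _ PM(2), unfolded o_def] linear_compose_sub linear_ident PM(1))
      ultimately have "(G has_derivative (\<lambda>x. A' (P x) + M (x - P x))) (at v)"
        unfolding G_def by (rule has_derivative_add)
      then show ?thesis by (rule that)
    qed
    obtain r where r: "r > 0" "ball v r \<subseteq> D" using v D(1) openE by blast
    have lbv: "c * norm (y - v) \<le> norm (G y - G v)" if "norm (y - v) < r" for y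
      using that r(2) v by (intro lb) (auto simp: dist_norm norm_minus_commute)
    have "inj G'" by (rule has_derivative_lower_bound_inj[OF G' c(1) r(1) lbv])
    then obtain g' where g': "linear g'" "g' \<circ> G' = id"
      using linear_injective_left_inverse[OF has_derivative_linear[OF G']] by blast
    have "continuous (at u) g" using contg u by (simp add: continuous_on_eq_continuous_at)
    then have dg: "(g has_derivative g') (at u)"
      using has_derivative_inverse_basic[of G G' g u g' "ball y0 R"] G' g' u g(2)
      by (simp add: v_def linear_conv_bounded_linear)
    define Q where "Q x = P (g' x)" for x
    have dPg: "((\<lambda>u. P (g u)) has_derivative Q) (at u)"
      unfolding Q_def by (rule has_derivative_compose[OF dg linear_imp_has_derivative[OF PM(1)]])
    have linQ: "linear Q" using has_derivative_linear[OF dPg] .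
    \<comment> \<open>\<open>Q\<close> is the derivative of the chart coordinate
      \<open>P (g u)\<close> with respect to the parameter, so moving the parameter along
      \<open>G' z\<close> moves the chart coordinate in direction \<open>z\<close>. A rational
      \<open>\<theta>\<close> close to \<open>G' z\<close> then still points into the cone.\<close>
    have "Q (G' z) = z" using g'(2) PW(2)[OF z(1)] by (simp add: Q_def o_def fun_eq_iff)
    obtain K where K: "K > 0" "\<And>x. norm (Q x) \<le> K * norm x" using linear_bounded_pos[OF linQ] by metis
    obtain \<theta> where \<theta>: "\<And>i. \<theta> $ i \<in> \<rat>" "norm (\<theta> - G' z) < \<epsilon> / 2 / K"
      using rational_approximation_vec[of "\<epsilon> / 2 / K"] z(2) K(1) by auto
    have Q\<theta>: "norm (Q \<theta> - z) < \<epsilon> / 2"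
    proof -
      have "Q \<theta> - z = Q (\<theta> - G' z)" using \<open>Q (G' z) = z\<close> by (simp add: linear_diff[OF linQ])
      then have "norm (Q \<theta> - z) \<le> K * norm (\<theta> - G' z)" using K(2) by simp
      also have "\<dots> < \<epsilon> / 2" using \<theta>(2) K(1) by (simp add: field_simps)
      finally show ?thesis .
    qed
    define L where "L = norm \<theta> + 1"
    have L: "L > 0" "norm \<theta> \<le> L" by (auto simp: L_def add_nonneg_pos)
    have "\<epsilon> / 2 / L > 0" using z L by simp
    then obtain d1 where d1: "d1 > 0" "\<And>u'. norm (u' - u) < d1 \<Longrightarrow>
        norm (P (g u') - P (g u) - Q (u' - u)) \<le> \<epsilon> / 2 / L * norm (u' - u)"
      using dPg[unfolded has_derivative_within_alt] by (metis UNIV_I)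
    obtain d2 where d2: "d2 > 0" "ball u d2 \<subseteq> ball y0 R" using u openE[OF open_ball] by metis
    define \<delta>3 where "\<delta>3 = min \<delta>0 (min (d1 / L) (d2 / L))"
    have \<delta>3: "\<delta>3 > 0" using z d1 d2 L by (simp add: \<delta>3_def)
    have "a \<bullet> s (u + t *\<^sub>R \<theta>) \<noteq> b" if t: "0 < t" "t < \<delta>3" for t
    proof -
      have "t * norm \<theta> \<le> t * L" using t L by (intro mult_left_mono) auto
      moreover have "t * L < d1" "t * L < d2" using t L by (auto simp: \<delta>3_def field_simps)
      ultimately have "t * norm \<theta> < d1" "t * norm \<theta> < d2" by linarith+
      then have tn: "norm (t *\<^sub>R \<theta>) < d1" "norm (t *\<^sub>R \<theta>) < d2" using t by simp_all
      have u': "u + t *\<^sub>R \<theta> \<in> ball y0 R"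
        by (rule subsetD[OF d2(2)]) (use tn(2) in \<open>simp add: dist_norm\<close>)
      \<comment> \<open>The difference quotient of the chart coordinate is within half of
        \<open>\<epsilon>\<close> of \<open>Q \<theta>\<close>, which in turn is that close to
        \<open>z\<close>; the path therefore runs inside the cone.\<close>
      define z' where "z' = (1 / t) *\<^sub>R (P (g (u + t *\<^sub>R \<theta>)) - w)"
      have "norm (P (g (u + t *\<^sub>R \<theta>)) - w - t *\<^sub>R Q \<theta>) \<le> \<epsilon> / 2 / L * (t * norm \<theta>)"
        using d1(2)[of "u + t *\<^sub>R \<theta>"] tn(1) t by (simp add: linear_cmul[OF linQ] w_def v_def)
      also have "\<dots> \<le> \<epsilon> / 2 / L * (t * L)" using L t z by (intro mult_left_mono) auto
      also have "\<dots> = t * (\<epsilon> / 2)" using L by simp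
      finally have "norm (P (g (u + t *\<^sub>R \<theta>)) - w - t *\<^sub>R Q \<theta>) \<le> t * (\<epsilon> / 2)" .
      moreover have "P (g (u + t *\<^sub>R \<theta>)) - w - t *\<^sub>R Q \<theta> = t *\<^sub>R (z' - Q \<theta>)"
        using t by (simp add: z'_def algebra_simps)
      ultimately have "norm (z' - Q \<theta>) \<le> \<epsilon> / 2" using t by simp
      then have "norm (z' - z) < \<epsilon>" using Q\<theta> norm_triangle_ineq[of "z' - Q \<theta>" "Q \<theta> - z"] by simp
      moreover have "z' \<in> W" using PW(1) w(2) ch(5) by (simp add: z'_def subspace_scale subspace_diff)
      ultimately have "?h (w + t *\<^sub>R z') \<noteq> 0" using t by (intro cone) (auto simp: \<delta>3_def)
      moreover have "w + t *\<^sub>R z' = P (g (u + t *\<^sub>R \<theta>))" using t by (simp add: z'_def)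
      ultimately show ?thesis by (simp add: s_def)
    qed
    then show ?thesis using \<theta>(1) \<delta>3 by blast
  qed
  show ?thesis
  proof (rule that[OF R(1) cJ conts s0])
    show "s u \<in> Y" if "u \<in> ball y0 R" for u using \<psi>Y[OF Vg[OF that] PW(1)] by (simp add: s_def)
  qed (use sJ escape in blast)+
qed

section \<open>Approximation on rational subspaces\<close>

text \<open>The condition in \<open>UA\<close> at a single time, since the construction controls one
  time interval after another.\<close>

definition approximable :: "(real \<Rightarrow> real) \<Rightarrow> real ^ 'n \<Rightarrow> real \<Rightarrow> bool" where
  "approximable f x t \<longleftrightarrow> (\<exists>(q :: int) (p :: int ^ 'n). q \<noteq> 0 \<and> \<bar>real_of_int q\<bar> \<le> t \<and>
     infnorm (real_of_int q *\<^sub>R x - (\<chi> i. real_of_int (p $ i))) \<le> f t)"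

lemma UA_iff: "x \<in> UA f \<longleftrightarrow> (\<forall>\<^sub>F t in at_top. approximable f x t)"
  by (simp add: UA_def approximable_def)

lemma infnorm_le_cart:
  fixes x :: "real ^ 'n"
  assumes "\<And>i. \<bar>x $ i\<bar> \<le> c"
  shows "infnorm x \<le> c"
  unfolding infnorm_cart by (rule cSup_least) (use assms in auto)

lemma common_denominator:
  assumes "finite A" and "\<And>x. x \<in> A \<Longrightarrow> f x \<in> (\<rat> :: real set)"
  shows "\<exists>N::nat. N > 0 \<and> (\<forall>x\<in>A. real N * f x \<in> \<int>)"
  using assms
proof (induction A rule: finite_induct)
  case empty
  then show ?case by auto
next
  case (insert x A)
  then obtain N where N: "N > 0" "\<And>y. y \<in> A \<Longrightarrow> real N * f y \<in> \<int>" by auto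
  have "f x \<in> \<rat>" using insert by simp
  then obtain i n where n: "(n::nat) \<noteq> 0" "f x = real_of_int i / real n"
    unfolding Rats_eq_int_div_nat by blast
  have "real (N * n) * f x = of_int (int N * i)" using n by simp
  then have "real (N * n) * f x \<in> \<int>" by (metis Ints_of_int)
  moreover have "real (N * n) * f y \<in> \<int>" if "y \<in> A" for y
  proof -
    have "real (N * n) * f y = of_int (int n) * (real N * f y)" by simp
    then show ?thesis using N(2)[OF that] by (metis Ints_mult Ints_of_int)
  qed
  ultimately show ?case using N(1) n(1) by (intro exI[of _ "N * n"]) auto
qed

text \<open>After clearing denominators, a point of the cylinder is governed by
  \<open>card J + 1\<close> real numbers: its coordinates in \<open>J\<close> and the parameter
  \<open>c\<close>. Simultaneous Dirichlet approximation of these numbers suffices, with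
  \<open>C\<close> and \<open>t0\<close> independent of \<open>x\<close> and
  \<open>c\<close>.\<close>

lemma cylinder_Dirichlet:
  fixes u \<theta> :: "real ^ 'n" and J :: "'n set"
  assumes "\<And>i. u $ i \<in> \<rat>" "\<And>i. \<theta> $ i \<in> \<rat>"
  obtains C t0 where "C > 0" "t0 \<ge> 1"
    "\<And>x c t. \<forall>i. i \<notin> J \<longrightarrow> x $ i = u $ i + c * \<theta> $ i \<Longrightarrow> t \<ge> t0 \<Longrightarrow>
       approximable (\<lambda>t. C * t powr - (1 / real (card J + 1))) x t"
proof -
  obtain N1 where N1: "N1 > 0" "\<And>i. real N1 * u $ i \<in> \<int>"
    using common_denominator[of UNIV "\<lambda>i. u $ i"] assms by auto
  obtain N2 where N2: "N2 > 0" "\<And>i. real N2 * \<theta> $ i \<in> \<int>"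
    using common_denominator[of UNIV "\<lambda>i. \<theta> $ i"] assms by auto
  define N where "N = N1 * N2"
  have N: "N > 0" using N1 N2 by (simp add: N_def)
  have "\<exists>a. real N * u $ i = of_int a" for i
  proof -
    have "real N * u $ i = of_int (int N2) * (real N1 * u $ i)" by (simp add: N_def)
    then show ?thesis using N1(2)[of i] by (metis Ints_mult Ints_of_int Ints_cases)
  qed
  then obtain a where a: "\<And>i. real N * u $ i = of_int (a i)" by metis
  have "\<exists>b. real N * \<theta> $ i = of_int b" for i
  proof -
    have "real N * \<theta> $ i = of_int (int N1) * (real N2 * \<theta> $ i)" by (simp add: N_def)
    then show ?thesis using N2(2)[of i] by (metis Ints_mult Ints_of_int Ints_cases)
  qed
  then obtain b where b: "\<And>i. real N * \<theta> $ i = of_int (b i)" by metis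
  define B where "B = 1 + (\<Sum>i\<in>UNIV. \<bar>real_of_int (b i)\<bar>)"
  have B: "B \<ge> 1" "\<And>i. \<bar>real_of_int (b i)\<bar> \<le> B"
  proof -
    show "B \<ge> 1" by (simp add: B_def sum_nonneg)
    show "\<bar>real_of_int (b i)\<bar> \<le> B" for i
      using member_le_sum[of i UNIV "\<lambda>i. \<bar>real_of_int (b i)\<bar>"] by (simp add: B_def)
  qed
  define k where "k = card J + 1"
  \<comment> \<open>\<open>N\<close> enters because the final denominator is \<open>N\<close> times
    Dirichlet's, \<open>B\<close> because the error in \<open>c\<close> is multiplied by
    \<open>b i\<close>, and 2 because a real number at least 1 is at most twice its floor.\<close>
  define C where "C = 2 * B * real N powr (1 / real k)"
  have C: "C > 0" using B N by (simp add: C_def)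
  obtain e where e: "bij_betw e {0..<card J} J" using ex_bij_betw_nat_finite[of J] by auto
  have main: "approximable (\<lambda>t. C * t powr - (1 / real k)) x t"
    if x: "\<forall>i. i \<notin> J \<longrightarrow> x $ i = u $ i + c * \<theta> $ i" and t: "t \<ge> real N" for x c t
  proof -
    define \<tau> where "\<tau> = t / real N"
    have \<tau>: "\<tau> \<ge> 1" using t N by (simp add: \<tau>_def)
    define y where "y = \<tau> powr (1 / real k)"
    have y: "y \<ge> 1" using \<tau> by (simp add: y_def ge_one_powr_ge_zero)
    define m where "m = nat \<lfloor>y\<rfloor>"
    have m: "m > 0" "real m \<le> y" "y < real m + 1" using y by (auto simp: m_def)
    have "k > 0" by (simp add: k_def)
    have "y ^ k = y powr real k" using y by (simp add: powr_realpow)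
    also have "\<dots> = \<tau>" using \<tau> \<open>k > 0\<close> by (simp add: y_def powr_powr)
    finally have yk: "y ^ k = \<tau>" .
    define \<theta>' where "\<theta>' i = (if i < card J then real N * x $ e i else c)" for i
    obtain q p where q: "0 < q" "q \<le> int (m ^ k)"
      and p: "\<And>i. i < k \<Longrightarrow> \<bar>of_int q * \<theta>' i - of_int (p i)\<bar> < 1 / real m"
      using Dirichlet_approx_simult[OF m(1), of k \<theta>'] by blast
    \<comment> \<open>Outside \<open>J\<close>,
      \<open>N * q * x $ i = q * a i + (q * c) * b i\<close>, so replacing \<open>q * c\<close> by
      its nearby integer yields an integer.\<close>
    define P where "P = (\<chi> i. if i \<in> J then p (inv_into {0..<card J} e i) else q * a i + p (card J) * b i)"
    have bd: "\<bar>(real_of_int (int N * q) *\<^sub>R x - (\<chi> i. real_of_int (P $ i))) $ i\<bar> \<le> B / real m" for i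
    proof (cases "i \<in> J")
      case True
      define j where "j = inv_into {0..<card J} e i"
      have "i \<in> e ` {0..<card J}" using True e by (simp add: bij_betw_def)
      then have j: "j < card J" "e j = i"
        using inv_into_into[of i e "{0..<card J}"] f_inv_into_f[of i e "{0..<card J}"] by (auto simp: j_def)
      have "(real_of_int (int N * q) *\<^sub>R x - (\<chi> i. real_of_int (P $ i))) $ i = of_int q * \<theta>' j - of_int (p j)"
        using True j by (simp add: P_def \<theta>'_def j_def)
      also have "\<bar>\<dots>\<bar> \<le> 1 / real m" using p[of j] j by (simp add: k_def)
      also have "\<dots> \<le> B / real m" using B(1) by (intro divide_right_mono) auto
      finally show ?thesis .
    next
      case False
      have "(real_of_int (int N * q) *\<^sub>R x - (\<chi> i. real_of_int (P $ i))) $ i =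
          of_int q * (real N * u $ i + c * (real N * \<theta> $ i)) - of_int (q * a i + p (card J) * b i)"
        using False x by (simp add: P_def algebra_simps)
      also have "\<dots> = (of_int q * \<theta>' (card J) - of_int (p (card J))) * of_int (b i)"
        unfolding a b by (simp add: \<theta>'_def algebra_simps)
      also have "\<bar>\<dots>\<bar> \<le> 1 / real m * B"
        unfolding abs_mult using p[of "card J"] B(2)[of i] by (intro mult_mono) (auto simp: k_def)
      finally show ?thesis by simp
    qed
    have "B / real m \<le> B * (2 / y)" 
    proof -
      have "real m \<ge> 1" using m(1) by simp
      then have "y \<le> 2 * real m" using m(3) by linarith
      then have "2 / (2 * real m) \<le> 2 / y" using y by (intro divide_left_mono) auto
      then have "1 / real m \<le> 2 / y" by simp
      then show ?thesis using B(1) mult_left_mono[of "1 / real m" "2 / y" B] by simp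
    qed
    also have "\<dots> = C * t powr - (1 / real k)"
      using N t by (simp add: C_def y_def \<tau>_def powr_divide powr_minus_divide)
    finally have le: "B / real m \<le> C * t powr - (1 / real k)" .
    have "real_of_int q \<le> real m ^ k" using q(2) by (metis of_int_le_iff of_int_of_nat_eq of_nat_power)
    also have "\<dots> \<le> y ^ k" using m by (intro power_mono) auto
    finally have "real_of_int q * real N \<le> t" using N by (simp add: yk \<tau>_def field_simps)
    then have "\<bar>real_of_int (int N * q)\<bar> \<le> t" using q(1) by (simp add: abs_mult mult.commute)
    moreover have "int N * q \<noteq> 0" using N q by simp
    moreover have "infnorm (real_of_int (int N * q) *\<^sub>R x - (\<chi> i. real_of_int (P $ i))) \<le> C * t powr - (1 / real k)"
      using infnorm_le_cart[OF bd] le by linarith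
    ultimately show ?thesis unfolding approximable_def by blast
  qed
  show ?thesis by (rule that[OF C _ main[unfolded k_def]]) (use N in auto)
qed

text \<open>\<open>T\<close> serves all points of the cylinder at once. The factor one half leaves
  room for a later perturbation of the point.\<close>

lemma cylinder_approximable:
  fixes u \<theta> :: "real ^ 'n" and J :: "'n set"
  assumes "\<And>i. u $ i \<in> \<rat>" "\<And>i. \<theta> $ i \<in> \<rat>"
    and f: "filterlim (\<lambda>t. t powr (1 / real (card J + 1)) * f t) at_top at_top"
  obtains T where "T \<ge> T0"
    "\<And>x c t. \<forall>i. i \<notin> J \<longrightarrow> x $ i = u $ i + c * \<theta> $ i \<Longrightarrow> t \<ge> T \<Longrightarrow> approximable (\<lambda>t. f t / 2) x t"
proof -
  obtain C t0 where C: "C > 0" "t0 \<ge> 1" "\<And>x c t. \<forall>i. i \<notin> J \<longrightarrow> x $ i = u $ i + c * \<theta> $ i \<Longrightarrow> t \<ge> t0 \<Longrightarrow>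
       approximable (\<lambda>t. C * t powr - (1 / real (card J + 1))) x t"
    by (rule cylinder_Dirichlet[where J = J, OF assms(1,2)]) (rule that)
  have "\<forall>\<^sub>F t in at_top. 2 * C \<le> t powr (1 / real (card J + 1)) * f t"
    using f by (simp add: filterlim_at_top)
  then obtain T1 where T1: "\<And>t. t \<ge> T1 \<Longrightarrow> 2 * C \<le> t powr (1 / real (card J + 1)) * f t"
    by (auto simp: eventually_at_top_linorder)
  show ?thesis
  proof (rule that[of "max T0 (max T1 t0)"])
    fix x c t assume x: "\<forall>i. i \<notin> J \<longrightarrow> x $ i = u $ i + c * \<theta> $ i" and t: "t \<ge> max T0 (max T1 t0)"
    have "C * t powr - (1 / real (card J + 1)) \<le> f t / 2"
      using T1[of t] t C(2) by (simp add: powr_minus_divide pos_divide_le_eq mult.commute)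
    moreover have "approximable (\<lambda>t. C * t powr - (1 / real (card J + 1))) x t"
      by (rule C(3)[OF x]) (use t in auto)
    ultimately show "approximable (\<lambda>t. f t / 2) x t"
      unfolding approximable_def by (meson order_trans)
  qed simp
qed

text \<open>On the compact interval \<open>f\<close> has a positive minimum \<open>\<mu>\<close>.
  With \<open>\<bar>q\<bar> \<le> T'\<close>, moving the point by less than
  \<open>\<mu> / (2 * T')\<close> shifts \<open>q *\<^sub>R x\<close> by at most
  \<open>\<mu> / 2\<close>, which the slack in the hypothesis absorbs.\<close>

lemma approximable_nearby:
  fixes x :: "real ^ 'n"
  assumes f: "\<And>t. t > 0 \<Longrightarrow> f t > 0" "continuous_on {0<..} f" and T: "0 < T" "T \<le> T'"
    and ap: "\<And>t. t \<ge> T \<Longrightarrow> approximable (\<lambda>t. f t / 2) x t"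
  obtains \<eta> where "\<eta> > 0"
    "\<And>x' t. dist x' x < \<eta> \<Longrightarrow> T \<le> t \<Longrightarrow> t \<le> T' \<Longrightarrow> approximable f x' t"
proof -
  have "continuous_on {T..T'} f" by (rule continuous_on_subset[OF f(2)]) (use T in auto)
  then obtain tm where tm: "tm \<in> {T..T'}" "\<And>t. t \<in> {T..T'} \<Longrightarrow> f tm \<le> f t"
    using continuous_attains_inf[of "{T..T'}" f] T(2) by auto
  define \<mu> where "\<mu> = f tm"
  have \<mu>: "\<mu> > 0" using f(1)[of tm] tm(1) T(1) by (simp add: \<mu>_def)
  show ?thesis
  proof (rule that[of "\<mu> / (2 * T')"])
    show "\<mu> / (2 * T') > 0" using \<mu> T by simp
    fix x' t assume x': "dist x' x < \<mu> / (2 * T')" and t: "T \<le> t" "t \<le> T'"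
    obtain q :: int and p :: "int ^ 'n" where qp: "q \<noteq> 0" "\<bar>real_of_int q\<bar> \<le> t"
      "infnorm (real_of_int q *\<^sub>R x - (\<chi> i. real_of_int (p $ i))) \<le> f t / 2"
      using ap[OF t(1)] unfolding approximable_def by blast
    have "infnorm (real_of_int q *\<^sub>R (x' - x)) \<le> T' * norm (x' - x)"
      unfolding infnorm_mul using qp(2) t infnorm_le_norm[of "x' - x"]
      by (intro mult_mono) (auto simp: infnorm_pos_le)
    also have "\<dots> \<le> \<mu> / 2" using x' T by (simp add: dist_norm field_simps)
    also have "\<dots> \<le> f t / 2" using tm(2)[of t] t by (simp add: \<mu>_def)
    finally have "infnorm (real_of_int q *\<^sub>R (x' - x)) \<le> f t / 2" .
    moreover have eq: "real_of_int q *\<^sub>R x' - (\<chi> i. real_of_int (p $ i)) =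
        real_of_int q *\<^sub>R (x' - x) + (real_of_int q *\<^sub>R x - (\<chi> i. real_of_int (p $ i)))"
      by (simp add: algebra_simps)
    moreover have "infnorm \<dots> \<le> infnorm (real_of_int q *\<^sub>R (x' - x)) +
        infnorm (real_of_int q *\<^sub>R x - (\<chi> i. real_of_int (p $ i)))"
      by (rule infnorm_triangle)
    ultimately have "infnorm (real_of_int q *\<^sub>R x' - (\<chi> i. real_of_int (p $ i))) \<le> f t"
      unfolding eq using qp(3) by linarith
    then show "approximable f x' t" unfolding approximable_def using qp by blast
  qed
qed

section \<open>Total irrationality and countability of rational data\<close>

text \<open>A proper subspace has an equation that fails somewhere; if \<open>x\<close> solves it,
  its normal vector cannot be 0. Only countably many hyperplanes thus have to be avoided.\<close>

lemma totally_irrationalI: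
  fixes x :: "real ^ 'n"
  assumes "\<And>a b. a \<noteq> 0 \<Longrightarrow> (\<And>i. a $ i \<in> \<rat>) \<Longrightarrow> b \<in> \<rat> \<Longrightarrow> a \<bullet> x \<noteq> b"
  shows "totally_irrational x"
  unfolding totally_irrational_def
proof
  assume "\<exists>L. rational_affine_subspace L \<and> L \<noteq> UNIV \<and> x \<in> L"
  then obtain L where L: "rational_affine_subspace L" "L \<noteq> UNIV" "x \<in> L" by blast
  from L(1) obtain E where E: "\<forall>(a, b)\<in>E. (\<forall>i. a $ i \<in> \<rat>) \<and> b \<in> \<rat>" "L = {x. \<forall>(a, b)\<in>E. a \<bullet> x = b}"
    unfolding rational_affine_subspace_def by (elim exE conjE)
  obtain y where "y \<notin> L" using L(2) by blast
  then obtain a b where ab: "(a, b) \<in> E" "a \<bullet> y \<noteq> b" unfolding E(2) by auto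
  have "a \<bullet> x = b" using bspec[OF L(3)[unfolded E(2), simplified] ab(1)] by simp
  moreover have "(\<forall>i. a $ i \<in> \<rat>) \<and> b \<in> \<rat>" using bspec[OF E(1) ab(1)] by simp
  moreover have "a \<noteq> 0" using ab(2) calculation(1) by auto
  ultimately show False using assms by blast
qed

lemma totally_irrational_component:
  fixes x :: "real ^ 'n"
  assumes "totally_irrational x"
  shows "x $ i \<notin> \<rat>"
proof
  assume r: "x $ i \<in> \<rat>"
  define L where "L = {y :: real ^ 'n. \<forall>(a, b)\<in>{(axis i 1, x $ i)}. a \<bullet> y = b}"
  have "rational_affine_subspace L"
    unfolding rational_affine_subspace_def L_def
    by (rule exI[of _ "{(axis i 1, x $ i)}"]) (use r in \<open>auto simp: axis_def\<close>)
  moreover have "x + axis i 1 \<notin> L" by (simp add: L_def inner_axis')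
  moreover have "x \<in> L" by (simp add: L_def inner_axis')
  ultimately show False using assms unfolding totally_irrational_def by blast
qed

lemma countable_rational_vectors: "countable {a :: real ^ 'n. \<forall>i. a $ i \<in> \<rat>}"
proof -
  have "countable (vec_lambda ` (PiE (UNIV :: 'n set) (\<lambda>_. \<rat> :: real set)))"
    by (intro countable_image countable_PiE countable_rat) auto
  moreover have "{a :: real ^ 'n. \<forall>i. a $ i \<in> \<rat>} \<subseteq> vec_lambda ` (PiE UNIV (\<lambda>_. \<rat>))"
  proof
    fix a :: "real ^ 'n" assume "a \<in> {a. \<forall>i. a $ i \<in> \<rat>}"
    then have "(\<lambda>i. a $ i) \<in> PiE UNIV (\<lambda>_. \<rat>)" by auto
    moreover have "a = vec_lambda (\<lambda>i. a $ i)" by simp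
    ultimately show "a \<in> vec_lambda ` (PiE UNIV (\<lambda>_. \<rat>))" by blast
  qed
  ultimately show ?thesis by (rule countable_subset[rotated])
qed

section \<open>The Khintchine-type construction\<close>

text \<open>Stage \<open>k\<close> leaves the \<open>k\<close>-th rational hyperplane and the point
  \<open>X k\<close>. With \<open>X\<close> an enumeration of a supposedly countable solution set,
  this is the diagonal argument for uncountability.\<close>

lemma exists_new_UA_star_point:
  fixes Y :: "(real ^ 'n) set" and X :: "nat \<Rightarrow> real ^ 'n"
  assumes Y: "real_analytic_submanifold d Y" "connected Y" "d \<ge> 1"
    and nH: "\<And>a b. a \<noteq> 0 \<Longrightarrow> (\<And>i. a $ i \<in> \<rat>) \<Longrightarrow> b \<in> \<rat> \<Longrightarrow> \<not> Y \<subseteq> {x. a \<bullet> x = b}"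
    and f: "\<And>t. t > 0 \<Longrightarrow> f t > 0" "continuous_on {0<..} f"
      "filterlim (\<lambda>t. t powr (1 / (real CARD('n) - real d + 1)) * f t) at_top at_top"
    and y0: "y0 \<in> Y" and e: "e > 0"
  obtains x where "x \<in> UA_star f \<inter> Y" "dist x y0 < e" "x \<notin> range X"
proof -
  obtain s R and J :: "'n set" where R: "R > 0" and cJ: "card J + d = CARD('n)"
    and conts: "continuous_on (ball y0 R) s" and s0: "s y0 = y0"
    and sY: "\<And>u. u \<in> ball y0 R \<Longrightarrow> s u \<in> Y"
    and sJ: "\<And>u i. u \<in> ball y0 R \<Longrightarrow> i \<notin> J \<Longrightarrow> s u $ i = u $ i"
    and escape: "\<And>u a b. u \<in> ball y0 R \<Longrightarrow> \<not> Y \<subseteq> {x. a \<bullet> x = b} \<Longrightarrow>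
       \<exists>\<theta>. (\<forall>i. \<theta> $ i \<in> \<rat>) \<and> (\<exists>\<delta>>0. \<forall>t. 0 < t \<and> t < \<delta> \<longrightarrow> a \<bullet> s (u + t *\<^sub>R \<theta>) \<noteq> b)"
    by (rule local_section[OF Y(1,2) y0]) (rule that)
  have fk: "filterlim (\<lambda>t. t powr (1 / real (card J + 1)) * f t) at_top at_top"
  proof -
    have "real CARD('n) - real d + 1 = real (card J + 1)" using cJ by (simp flip: cJ)
    then show ?thesis using f(3) by (simp only:)
  qed
  \<comment> \<open>The section fixes the coordinate \<open>i0\<close>, so \<open>s u\<close> has a
    rational coordinate whenever \<open>u\<close> is rational and cannot equal a totally irrational
    \<open>X k\<close>.\<close>
  have "J \<noteq> UNIV" using cJ Y(3) by auto
  then obtain i0 where i0: "i0 \<notin> J" by blast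
  have conts_at: "isCont s u" if "u \<in> ball y0 R" for u
    using conts that by (simp add: continuous_on_eq_continuous_at)
  define HH where "HH = {a :: real ^ 'n. a \<noteq> 0 \<and> (\<forall>i. a $ i \<in> \<rat>)} \<times> (\<rat> :: real set)"
  have "countable HH"
    unfolding HH_def
    by (intro countable_SIGMA countable_rat countable_subset[OF _ countable_rational_vectors]) auto
  have "(axis undefined 1, 0) \<in> HH" by (auto simp: HH_def axis_def vec_eq_iff)
  then have HHne: "HH \<noteq> {}" by blast
  define hp where "hp = from_nat_into HH"
  have hp: "hp k \<in> HH" for k unfolding hp_def by (rule from_nat_into[OF HHne])
  have range_hp: "range hp = HH" unfolding hp_def by (rule range_from_nat_into[OF HHne \<open>countable HH\<close>])
  obtain r0 where r0: "r0 > 0" "r0 \<le> R" "\<And>u. u \<in> ball y0 r0 \<Longrightarrow> dist (s u) y0 < e"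
  proof -
    have "y0 \<in> ball y0 R" using R by simp
    then obtain d0 where "d0 > 0" "\<And>u. dist u y0 < d0 \<Longrightarrow> dist (s u) (s y0) < e"
      using conts_at[unfolded continuous_at_eps_delta] e by blast
    then show ?thesis using that[of "min d0 R"] R by (simp add: s0 dist_commute)
  qed
  \<comment> \<open>The centre is approximable for all times from \<open>T\<close> on, with the
    slack \<open>f t / 2\<close>; the whole next ball will be so only up to the next time, with
    \<open>f t\<close>.\<close>
  define Inv where "Inv u r T \<longleftrightarrow> (\<forall>i. u $ i \<in> \<rat>) \<and> r > 0 \<and> cball u r \<subseteq> ball y0 r0 \<and> T \<ge> (1::real) \<and>
      (\<forall>t\<ge>T. approximable (\<lambda>t. f t / 2) (s u) t)" for u r T
  define Step where "Step k u r T u' r' T' \<longleftrightarrow> cball u' r' \<subseteq> cball u r \<and> T' \<ge> T + 1 \<and>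
      (\<forall>v\<in>cball u' r'. (\<forall>t. T \<le> t \<longrightarrow> t \<le> T' \<longrightarrow> approximable f (s v) t) \<and>
         fst (hp k) \<bullet> s v \<noteq> snd (hp k) \<and> (s v \<noteq> X k \<or> \<not> totally_irrational (X k)))"
    for k :: nat and u :: "real ^ 'n" and r T :: real and u' :: "real ^ 'n" and r' T' :: real
  have init: "\<exists>u r T. Inv u r T"
  proof -
    obtain u where u: "\<And>i. u $ i \<in> \<rat>" "norm (u - y0) < r0 / 2"
      using rational_approximation_vec[of "r0 / 2" y0] r0(1) by auto
    have sub: "cball u (r0 / 2) \<subseteq> ball y0 r0"
    proof
      fix v assume "v \<in> cball u (r0 / 2)"
      then show "v \<in> ball y0 r0"
        using u(2) dist_triangle[of y0 v u] by (simp add: dist_norm norm_minus_commute)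
    qed
    have "u \<in> ball y0 R" using sub r0 by (meson centre_in_cball half_gt_zero less_imp_le subsetD subset_ball)
    \<comment> \<open>Direction 0 is a degenerate line, which is enough to start.\<close>
    obtain T where T: "T \<ge> 1" "\<And>x c t. \<forall>i. i \<notin> J \<longrightarrow> x $ i = u $ i + c * 0 $ i \<Longrightarrow> t \<ge> T \<Longrightarrow>
        approximable (\<lambda>t. f t / 2) x t"
      by (rule cylinder_approximable[of u 0, OF u(1) _ fk]) (auto intro: that)
    have "Inv u (r0 / 2) T"
      unfolding Inv_def using u(1) r0(1) sub T(1) T(2)[of "s u" 0] sJ[OF \<open>u \<in> ball y0 R\<close>] by auto
    then show ?thesis by blast
  qed
  have step: "\<exists>u' r' T'. Inv u' r' T' \<and> Step k u r T u' r' T'" if inv: "Inv u r T" for k u r T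
  proof -
    have u: "\<And>i. u $ i \<in> \<rat>" and r: "r > 0" "cball u r \<subseteq> ball y0 r0" and T: "T \<ge> 1"
      and ap: "\<And>t. t \<ge> T \<Longrightarrow> approximable (\<lambda>t. f t / 2) (s u) t"
      using inv unfolding Inv_def by auto
    have rR: "cball u r \<subseteq> ball y0 R" using r(2) r0(2) by (meson subset_ball subset_trans)
    have uR: "u \<in> ball y0 R" using rR r(1) by (meson centre_in_cball less_imp_le subsetD)
    obtain a b where ab: "hp k = (a, b)" by (cases "hp k")
    have "\<not> Y \<subseteq> {x. a \<bullet> x = b}" by (rule nH) (use hp[of k] ab in \<open>auto simp: HH_def\<close>)
    then obtain \<theta> \<delta> where \<theta>: "\<And>i. \<theta> $ i \<in> \<rat>" "\<delta> > 0" "\<And>t. 0 < t \<Longrightarrow> t < \<delta> \<Longrightarrow> a \<bullet> s (u + t *\<^sub>R \<theta>) \<noteq> b"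
      using escape[OF uR] by blast
    \<comment> \<open>\<open>T'\<close> is valid along the whole line through \<open>u\<close>, so
      the step length \<open>t\<close> may be chosen afterwards.\<close>
    obtain T' where T': "T' \<ge> T + 1" "\<And>x c t. \<forall>i. i \<notin> J \<longrightarrow> x $ i = u $ i + c * \<theta> $ i \<Longrightarrow> t \<ge> T' \<Longrightarrow>
        approximable (\<lambda>t. f t / 2) x t"
      by (rule cylinder_approximable[OF u \<theta>(1) fk, of "T + 1"]) (rule that)
    obtain \<eta> where \<eta>: "\<eta> > 0" "\<And>x' t. dist x' (s u) < \<eta> \<Longrightarrow> T \<le> t \<Longrightarrow> t \<le> T' \<Longrightarrow> approximable f x' t"
      by (rule approximable_nearby[OF f(1,2) _ _ ap, of T T']) (use T T'(1) that in auto)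
    obtain \<rho> where \<rho>: "\<rho> > 0" "\<And>v. dist v u < \<rho> \<Longrightarrow> dist (s v) (s u) < \<eta>"
      using conts_at[OF uR, unfolded continuous_at_eps_delta] \<eta>(1) by blast
    define \<rho>' where "\<rho>' = min \<rho> r"
    have \<rho>': "\<rho>' > 0" using \<rho> r by (simp add: \<rho>'_def)
    obtain t where t: "t \<in> \<rat>" "0 < t" "t < min \<delta> (\<rho>' / (norm \<theta> + 1))"
      using Rats_dense_in_real[of 0 "min \<delta> (\<rho>' / (norm \<theta> + 1))"] \<theta>(2) \<rho>' by (auto simp: add_nonneg_pos)
    define u' where "u' = u + t *\<^sub>R \<theta>"
    have "t * norm \<theta> \<le> t * (norm \<theta> + 1)" using t(2) by simp
    also have "\<dots> < \<rho>'" using t(3) by (simp add: pos_less_divide_eq add_nonneg_pos)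
    finally have u'\<rho>: "u' \<in> ball u \<rho>'" using t(2) by (simp add: u'_def dist_norm)
    have "ball u \<rho>' \<subseteq> cball u r" by (auto simp: \<rho>'_def)
    then have u'R: "u' \<in> ball y0 R" using u'\<rho> rR by blast
    have u'Q: "u' $ i \<in> \<rat>" for i using u \<theta>(1) t(1) by (simp add: u'_def)
    have H: "a \<bullet> s u' \<noteq> b" using \<theta>(3)[of t] t by (simp add: u'_def)
    have nX: "s u' \<noteq> X k \<or> \<not> totally_irrational (X k)"
      using totally_irrational_component[of "X k" i0] sJ[OF u'R i0] u'Q[of i0] by auto
    have cu': "isCont s u'" by (rule conts_at[OF u'R])
    have "\<forall>\<^sub>F v in nhds u'. a \<bullet> s v \<noteq> b"
    proof -
      have "isCont (\<lambda>v. a \<bullet> s v) u'" by (intro continuous_intros cu')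
      then have "((\<lambda>v. a \<bullet> s v) \<longlongrightarrow> a \<bullet> s u') (nhds u')"
        unfolding isCont_def by (rule tendsto_at_iff_tendsto_nhds[of "\<lambda>v. a \<bullet> s v" u', THEN iffD1])
      then show ?thesis using H by (rule tendsto_imp_eventually_ne)
    qed
    moreover have "\<forall>\<^sub>F v in nhds u'. s v \<noteq> X k \<or> \<not> totally_irrational (X k)"
    proof (cases "totally_irrational (X k)")
      case True
      have "(s \<longlongrightarrow> s u') (nhds u')" 
        using cu' unfolding isCont_def by (rule tendsto_at_iff_tendsto_nhds[THEN iffD1])
      then have "\<forall>\<^sub>F v in nhds u'. s v \<noteq> X k" by (rule tendsto_imp_eventually_ne) (use nX True in auto)
      then show ?thesis by eventually_elim simp
    qed simp
    moreover have "\<forall>\<^sub>F v in nhds u'. v \<in> ball u \<rho>'"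
      using u'\<rho> by (intro eventually_nhds_in_open) auto
    ultimately have "\<forall>\<^sub>F v in nhds u'. a \<bullet> s v \<noteq> b \<and> (s v \<noteq> X k \<or> \<not> totally_irrational (X k)) \<and> v \<in> ball u \<rho>'"
      by eventually_elim blast
    then obtain d1 where d1: "d1 > 0" "\<And>v. dist v u' < d1 \<Longrightarrow>
        a \<bullet> s v \<noteq> b \<and> (s v \<noteq> X k \<or> \<not> totally_irrational (X k)) \<and> v \<in> ball u \<rho>'"
      unfolding eventually_nhds_metric by blast
    define r' where "r' = d1 / 2"
    have r': "r' > 0" using d1 by (simp add: r'_def)
    have near: "a \<bullet> s v \<noteq> b \<and> (s v \<noteq> X k \<or> \<not> totally_irrational (X k)) \<and> v \<in> ball u \<rho>'" if "v \<in> cball u' r'" for v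
      using that d1 by (intro d1(2)) (simp add: r'_def dist_commute)
    have sub: "cball u' r' \<subseteq> cball u r" using near \<open>ball u \<rho>' \<subseteq> cball u r\<close> by blast
    have "approximable (\<lambda>t. f t / 2) (s u') t'" if "t' \<ge> T'" for t'
      by (rule T'(2)[of _ t, OF _ that]) (use sJ[OF u'R] in \<open>simp add: u'_def\<close>)
    then have "Inv u' r' T'"
      unfolding Inv_def using u'Q r' sub r(2) T T'(1) by auto
    moreover have "approximable f (s v) t'" if "v \<in> cball u' r'" "T \<le> t'" "t' \<le> T'" for v t'
    proof (rule \<eta>(2)[OF \<rho>(2) that(2,3)])
      show "dist v u < \<rho>" using near[OF that(1)] by (simp add: \<rho>'_def dist_commute)
    qed
    then have "Step k u r T u' r' T'"
      unfolding Step_def using sub T'(1) near ab by auto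
    ultimately show ?thesis by blast
  qed
  have "\<exists>F. \<forall>k. Inv (fst (F k)) (fst (snd (F k))) (snd (snd (F k))) \<and>
      Step k (fst (F k)) (fst (snd (F k))) (snd (snd (F k)))
        (fst (F (Suc k))) (fst (snd (F (Suc k)))) (snd (snd (F (Suc k))))"
  proof (rule dependent_nat_choice[of "\<lambda>_ x. Inv (fst x) (fst (snd x)) (snd (snd x))"
      "\<lambda>k x y. Step k (fst x) (fst (snd x)) (snd (snd x)) (fst y) (fst (snd y)) (snd (snd y))"])
    show "\<exists>x. Inv (fst x) (fst (snd x)) (snd (snd x))"
      using init by simp
    show "\<exists>y. Inv (fst y) (fst (snd y)) (snd (snd y)) \<and>
        Step k (fst x) (fst (snd x)) (snd (snd x)) (fst y) (fst (snd y)) (snd (snd y))"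
      if "Inv (fst x) (fst (snd x)) (snd (snd x))" for x k
      using step[OF that] by simp
  qed
  then obtain F where F: "\<forall>k. Inv (fst (F k)) (fst (snd (F k))) (snd (snd (F k))) \<and>
      Step k (fst (F k)) (fst (snd (F k))) (snd (snd (F k)))
        (fst (F (Suc k))) (fst (snd (F (Suc k)))) (snd (snd (F (Suc k))))" ..
  define u r T where "u k = fst (F k)" and "r k = fst (snd (F k))" and "T k = snd (snd (F k))" for k
  have inv: "Inv (u k) (r k) (T k)" for k
    using F by (simp add: u_def r_def T_def)
  have st: "Step k (u k) (r k) (T k) (u (Suc k)) (r (Suc k)) (T (Suc k))" for k
    using F by (simp add: u_def r_def T_def)
  have "\<Inter>(range (\<lambda>k. cball (u k) (r k))) \<noteq> {}"
  proof (rule compact_nest)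
    show "cball (u k) (r k) \<noteq> {}" for k using inv[of k] by (simp add: Inv_def)
    show "cball (u n) (r n) \<subseteq> cball (u m) (r m)" if "m \<le> n" for m n
      using that by (rule lift_Suc_antimono_le[of "\<lambda>k. cball (u k) (r k)", rotated]) (use st in \<open>simp add: Step_def\<close>)
  qed simp
  then obtain v where v: "\<And>k. v \<in> cball (u k) (r k)" by blast
  have vs: "fst (hp k) \<bullet> s v \<noteq> snd (hp k)" "s v \<noteq> X k \<or> \<not> totally_irrational (X k)"
    "\<And>t. T k \<le> t \<Longrightarrow> t \<le> T (Suc k) \<Longrightarrow> approximable f (s v) t" for k
    using st[of k] v[of "Suc k"] unfolding Step_def by auto
  have vr0: "v \<in> ball y0 r0" using inv[of 0] v[of 0] by (auto simp: Inv_def)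
  have ti: "totally_irrational (s v)"
  proof (rule totally_irrationalI)
    fix a :: "real ^ 'n" and b :: real assume "a \<noteq> 0" "\<And>i. a $ i \<in> \<rat>" "b \<in> \<rat>"
    then have "(a, b) \<in> range hp" unfolding range_hp HH_def by simp
    then obtain k where "hp k = (a, b)" by (metis rangeE)
    then show "a \<bullet> s v \<noteq> b" using vs(1)[of k] by simp
  qed
  \<comment> \<open>The gain of at least 1 at each stage makes the intervals between consecutive
    times cover everything from \<open>T 0\<close> on.\<close>
  have Tgrow: "T 0 + real k \<le> T k" for k
  proof (induction k)
    case (Suc k)
    then show ?case using st[of k] by (simp add: Step_def)
  qed simp
  have "approximable f (s v) t" if t: "t \<ge> T 0" for t
  proof -
    have "\<exists>k. t \<le> T (Suc k)"
    proof -
      obtain k where "t - T 0 \<le> real k" using real_arch_simple by blast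
      then show ?thesis using Tgrow[of "Suc k"] by (intro exI[of _ k]) simp
    qed
    define k where "k = (LEAST k. t \<le> T (Suc k))"
    have "t \<le> T (Suc k)" unfolding k_def by (rule LeastI_ex) fact
    moreover have "T k \<le> t"
    proof (cases k)
      case (Suc j)
      then have "\<not> t \<le> T (Suc j)" using not_less_Least[of j "\<lambda>k. t \<le> T (Suc k)"] by (simp add: k_def)
      then show ?thesis using Suc by simp
    qed (use t in simp)
    ultimately show ?thesis using vs(3) by blast
  qed
  then have "s v \<in> UA f" unfolding UA_iff eventually_at_top_linorder by blast
  then have "s v \<in> UA_star f \<inter> Y"
    using ti sY[of v] vr0 r0(2) by (simp add: UA_star_def)
  moreover have "s v \<notin> range X" using vs(2) ti by auto
  ultimately show ?thesis using that r0(3)[OF vr0] by blast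
qed

section \<open>Density, uncountability and the uniform exponent\<close>

lemma UA_star_dense_uncountable:
  fixes Y :: "(real ^ 'n) set"
  assumes Y: "real_analytic_submanifold d Y" "connected Y" "d \<ge> 1"
    and nH: "\<not> (\<exists>H. rational_affine_hyperplane H \<and> Y \<subseteq> H)"
    and f: "\<And>t. t > 0 \<Longrightarrow> f t > 0" "continuous_on {0<..} f"
      "filterlim (\<lambda>t. t powr (1 / (real CARD('n) - real d + 1)) * f t) at_top at_top"
  shows "Y \<subseteq> closure (UA_star f \<inter> Y)" "uncountable (UA_star f \<inter> Y)"
proof -
  have nH': "\<not> Y \<subseteq> {x. a \<bullet> x = b}" if "a \<noteq> 0" "\<And>i. a $ i \<in> \<rat>" "b \<in> \<rat>" for a b
    using nH that unfolding rational_affine_hyperplane_def by blast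
  have new: "\<exists>x. x \<in> UA_star f \<inter> Y \<and> dist x y < e \<and> x \<notin> range X" if "y \<in> Y" "e > 0"
    for y e and X :: "nat \<Rightarrow> real ^ 'n"
    by (rule exists_new_UA_star_point[OF Y nH' f that, of X]) blast+
  show "Y \<subseteq> closure (UA_star f \<inter> Y)"
    unfolding closure_approachable subset_iff using new by blast
  show "uncountable (UA_star f \<inter> Y)"
  proof
    assume c: "countable (UA_star f \<inter> Y)"
    have "\<not> Y \<subseteq> {x. axis undefined 1 \<bullet> x = 0}"
      by (rule nH') (auto simp: axis_def vec_eq_iff)
    then obtain y where y: "y \<in> Y" by blast
    have "UA_star f \<inter> Y \<noteq> {}" using new[OF y, of 1] by auto
    then have "range (from_nat_into (UA_star f \<inter> Y)) = UA_star f \<inter> Y"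
      using c by (rule range_from_nat_into)
    then show False using new[OF y, of 1 "from_nat_into (UA_star f \<inter> Y)"] by auto
  qed
qed

lemma uniform_exponent_ge:
  assumes "c > 0" and "\<And>a. 0 < a \<Longrightarrow> a < c \<Longrightarrow> x \<in> UA (\<lambda>t. t powr - a)"
  shows "ereal c \<le> uniform_exponent x"
proof (rule ereal_le_real)
  fix z assume z: "uniform_exponent x \<le> ereal z"
  have "c \<le> z"
  proof (rule dense_le_bounded[OF assms(1)])
    fix a assume "0 < a" "a < c"
    then have "ereal a \<le> uniform_exponent x"
      unfolding uniform_exponent_def using assms(2) by (intro SUP_upper) auto
    then have "ereal a \<le> ereal z" using z by (rule order_trans)
    then show "a \<le> z" by simp
  qed
  then show "ereal c \<le> ereal z" by simp
qed

theorem theorem1p13: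
  fixes Y :: "(real ^ 'n) set" and d :: nat
  assumes "real_analytic_submanifold d Y"
    and "connected Y"
    and "d \<ge> 2"
    and "\<not> (\<exists>H. rational_affine_hyperplane H \<and> Y \<subseteq> H)"
  shows "(\<forall>f :: real \<Rightarrow> real.
            (\<forall>t>0. f t > 0) \<and> continuous_on {0<..} f \<and> antimono_on {0<..} f \<and>
            mono_on {0<..} (\<lambda>t. t powr (1 / (real CARD('n) - real d + 1)) * f t) \<and>
            filterlim (\<lambda>t. t powr (1 / (real CARD('n) - real d + 1)) * f t) at_top at_top
            \<longrightarrow> Y \<subseteq> closure (UA_star f \<inter> Y) \<and> uncountable (UA_star f \<inter> Y)) \<and>
         (\<exists>S. S \<subseteq> Y \<and> Y \<subseteq> closure S \<and> uncountable S \<and>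
            (\<forall>x\<in>S. totally_irrational x \<and>
               uniform_exponent x \<ge> ereal (1 / (real CARD('n) - real d + 1))))"
proof -
  define c where "c = 1 / (real CARD('n) - real d + 1)"
  have d1: "d \<ge> 1" using assms(3) by simp
  note main = UA_star_dense_uncountable[OF assms(1,2) d1 assms(4)]
  have c: "c > 0"
  proof -
    \<comment> \<open>A chart at a point of \<open>Y\<close> contains a \<open>d\<close>-dimensional
      subspace, hence \<open>d \<le> CARD('n)\<close>; the empty set is excluded because it lies in
      every hyperplane.\<close>
    have "Y \<noteq> {}"
    proof
      assume "Y = {}"
      moreover have "rational_affine_hyperplane {x :: real ^ 'n. axis undefined 1 \<bullet> x = 0}"
        unfolding rational_affine_hyperplane_def
        by (intro exI[of _ "axis undefined 1"] exI[of _ 0]) (auto simp: axis_def vec_eq_iff)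
      ultimately show False using assms(4) by blast
    qed
    then obtain y where "y \<in> Y" by blast
    then obtain W :: "(real ^ 'n) set" where "dim W = d"
      using assms(1) unfolding real_analytic_submanifold_def by metis
    then have "d \<le> CARD('n)" using dim_subset_UNIV_cart[of W] by simp
    then show ?thesis by (simp add: c_def)
  qed
  \<comment> \<open>For the pure power the product with \<open>t powr c\<close> stays bounded; a
    logarithm makes it diverge without affecting exponents below \<open>c\<close>, and the maximum
    with 1 keeps \<open>f\<close> positive.\<close>
  define f where "f t = t powr - c * max 1 (ln t)" for t
  have fpos: "f t > 0" if "t > 0" for t using that by (simp add: f_def less_max_iff_disj)
  have fcont: "continuous_on {0<..} f" unfolding f_def by (intro continuous_intros) auto
  have flim: "filterlim (\<lambda>t. t powr c * f t) at_top at_top"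
  proof (rule filterlim_at_top_mono[OF ln_at_top])
    show "\<forall>\<^sub>F t in at_top. ln t \<le> t powr c * f t"
      using eventually_gt_at_top[of 0] by eventually_elim (simp add: f_def flip: mult.assoc powr_add)
  qed
  have exponent: "ereal c \<le> uniform_exponent x" if x: "x \<in> UA_star f" for x :: "real ^ 'n"
  proof (rule uniform_exponent_ge[OF c])
    fix a assume a: "0 < a" "a < c"
    define b where "b = (c - a) / 2"
    have b: "b > 0" using a by (simp add: b_def)
    \<comment> \<open>Beyond the threshold \<open>t powr b\<close> is at least \<open>1 / b\<close>,
      so \<open>ln t \<le> t powr b / b\<close> is at most \<open>t powr (2 * b)\<close>, which is
      \<open>t powr (c - a)\<close>.\<close>
    have "\<forall>\<^sub>F t in at_top. f t \<le> t powr - a"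
      using eventually_ge_at_top[of "max 1 ((1 / b) powr (1 / b))"]
    proof eventually_elim
      case (elim t)
      have "1 / b = ((1 / b) powr (1 / b)) powr b" using b by (simp add: powr_powr)
      also have "\<dots> \<le> t powr b" using elim b by (intro powr_mono2) auto
      finally have "1 / b \<le> t powr b" .
      have "ln t \<le> t powr b / b" using elim b by (intro ln_powr_bound) auto
      also have "\<dots> = t powr b * (1 / b)" by simp
      also have "\<dots> \<le> t powr b * t powr b" using \<open>1 / b \<le> t powr b\<close> by (intro mult_left_mono) auto
      also have "\<dots> = t powr (c - a)" by (simp add: b_def flip: powr_add)
      finally have "max 1 (ln t) \<le> t powr (c - a)" using elim a by (simp add: ge_one_powr_ge_zero)
      then have "f t \<le> t powr - c * t powr (c - a)" unfolding f_def by (intro mult_left_mono) auto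
      then show ?case by (simp flip: powr_add)
    qed
    moreover have "\<forall>\<^sub>F t in at_top. approximable f x t" using x by (simp add: UA_star_def UA_iff)
    ultimately show "x \<in> UA (\<lambda>t. t powr - a)"
      unfolding UA_iff
      by eventually_elim (unfold approximable_def, meson order_trans)
  qed
  show ?thesis
  proof (intro conjI allI impI)
    show "\<exists>S. S \<subseteq> Y \<and> Y \<subseteq> closure S \<and> uncountable S \<and> (\<forall>x\<in>S. totally_irrational x \<and>
        uniform_exponent x \<ge> ereal (1 / (real CARD('n) - real d + 1)))"
      using main[OF fpos fcont flim[unfolded c_def]] exponent
      by (intro exI[of _ "UA_star f \<inter> Y"]) (auto simp: UA_star_def c_def)
  qed (elim conjE, rule main; blast)+
qed

end
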